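(* Let $Z\in\mathbb{R}^{m\times n}$, $\mu>0$, and let $\gamma>0$ be a threshold such that, for every $\sigma$ with $0\le\sigma\le\gamma$, the solution of $\min_{y\ge0}\frac12(y-\sigma)^2+\mu\hat r(y)$ is $y^*=0$. Assume that $Z$ has $\hat k$ singular values larger than $\gamma$, and let $U_{\hat k}\Sigma_{\hat k}V_{\hat k}^\top$ be its rank-$\hat k$ (truncated) SVD. Assume that $Q\in\mathbb{R}^{m\times k}$, where $k\ge\hat k$, is orthogonal (i.e. $Q^\top Q=I$) and $\mathrm{span}(U_{\hat k})\subseteq\mathrm{span}(Q)$. Then $$\mathrm{prox}_{\mu r}(Z)=Q\cdot \mathrm{prox}_{\mu r}(Q^\top Z).$$
   Context: $m\le n$. The regularizer is $r(X)=\sum_i\hat r(\sigma_i(X))$, the sum being over the singular values of $X$ (for a matrix of any size), where $\hat r:[0,\infty)\to\mathbb{R}$ is concave, non-decreasing, with $\hat r(0)=0$. The proximal operator is $\mathrm{prox}_{\mu r}(Z)=\arg\min_X\frac12\|X-Z\|_F^2+\mu r(X)$; it is given by $\mathrm{prox}_{\mu r}(Z)=U\,\mathrm{Diag}(y^* )V^\top$, where $Z=U\Sigma V^\top$ is the SVD of $Z$ with singular values $\sigma_i$, and $y_i^*\in\arg\min_{y\ge0}\frac12(y-\sigma_i)^2+\mu\hat r(y)$, where the choice of $y_i^*$ depends only on $\sigma_i$. $\mathrm{span}(\cdot)$ denotes the column span. *)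

theory Defs
  imports
    "HOL-Analysis.Convex"
    "Jordan_Normal_Form.VS_Connect"
begin

definition frobenius_norm :: "real mat \<Rightarrow> real" where
  "frobenius_norm A = sqrt (\<Sum>i<dim_row A. \<Sum>j<dim_col A. (A $$ (i, j))\<^sup>2)"

definition diag_of_list :: "real list \<Rightarrow> real mat" where
  "diag_of_list ds = mat_diag (length ds) (\<lambda>i. ds ! i)"

definition first_cols :: "nat \<Rightarrow> real mat \<Rightarrow> real mat" where
  "first_cols r A = mat_of_cols (dim_row A) (take r (cols A))"

text \<open>The thin singular value decomposition \<open>A = U Diag(\<sigma>) V\<^sup>T\<close>: with
  \<open>p = min m n\<close> for an \<open>m \<times> n\<close> matrix, \<open>U\<close> is \<open>m \<times> p\<close>, \<open>V\<close> is \<open>n \<times> p\<close>, and \<open>\<sigma>\<close> lists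
  all \<open>p\<close> singular values (zeros included) in non-increasing order.\<close>

definition is_svd :: "real mat \<Rightarrow> real mat \<Rightarrow> real list \<Rightarrow> real mat \<Rightarrow> bool" where
  "is_svd A U \<sigma> V \<longleftrightarrow>
     (let p = min (dim_row A) (dim_col A) in
       U \<in> carrier_mat (dim_row A) p \<and> U\<^sup>T * U = 1\<^sub>m p \<and>
       V \<in> carrier_mat (dim_col A) p \<and> V\<^sup>T * V = 1\<^sub>m p \<and>
       length \<sigma> = p \<and> (\<forall>s \<in> set \<sigma>. 0 \<le> s) \<and> sorted_wrt (\<ge>) \<sigma> \<and>
       A = U * diag_of_list \<sigma> * V\<^sup>T)"

definition singular_values :: "real mat \<Rightarrow> real list" where
  "singular_values A = (THE \<sigma>. \<exists>U V. is_svd A U \<sigma> V)"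

definition is_truncated_svd ::
    "nat \<Rightarrow> real mat \<Rightarrow> real mat \<Rightarrow> real list \<Rightarrow> real mat \<Rightarrow> bool" where
  "is_truncated_svd r A Ur \<sigma>r Vr \<longleftrightarrow>
     r \<le> min (dim_row A) (dim_col A) \<and>
     (\<exists>U \<sigma> V. is_svd A U \<sigma> V \<and>
       Ur = first_cols r U \<and> \<sigma>r = take r \<sigma> \<and> Vr = first_cols r V)"

definition spectral_reg :: "(real \<Rightarrow> real) \<Rightarrow> real mat \<Rightarrow> real" where
  "spectral_reg rhat X = sum_list (map rhat (singular_values X))"

text \<open>The scalar problem need not have a unique solution.  A choice of solution that depends
  only on \<open>\<sigma>\<close> (and not on the matrix or on the index of the singular value) is a function
  \<open>ystar\<close> of \<open>\<sigma>\<close>.\<close>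

definition is_scalar_prox :: "real \<Rightarrow> (real \<Rightarrow> real) \<Rightarrow> (real \<Rightarrow> real) \<Rightarrow> bool" where
  "is_scalar_prox \<mu> rhat ystar \<longleftrightarrow>
     (\<forall>\<sigma>\<ge>0. is_arg_min (\<lambda>y. 1/2 * (y - \<sigma>)\<^sup>2 + \<mu> * rhat y) (\<lambda>y. 0 \<le> y) (ystar \<sigma>))"

text \<open>The matrix problem need not have a unique minimizer either, so the proximal operator is
  the minimizer obtained from the scalar choice \<open>ystar\<close>.  For non-decreasing \<open>rhat\<close> with
  \<open>rhat 0 = 0\<close> and \<open>\<mu> > 0\<close>, the scalar problem at \<open>0\<close> has the only solution \<open>0\<close>; hence
  \<open>ystar 0 = 0\<close> and the matrix \<open>U Diag(ystar \<sigma>) V\<^sup>T\<close> does not depend on the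
  singular value decomposition chosen, which makes the description below definite.\<close>

definition prox ::
    "real \<Rightarrow> (real \<Rightarrow> real) \<Rightarrow> (real \<Rightarrow> real) \<Rightarrow> real mat \<Rightarrow> real mat" where
  "prox \<mu> rhat ystar Z =
     (THE X.
       is_arg_min (\<lambda>X. 1/2 * (frobenius_norm (X - Z))\<^sup>2 + \<mu> * spectral_reg rhat X)
         (\<lambda>X. X \<in> carrier_mat (dim_row Z) (dim_col Z)) X \<and>
       (\<exists>U \<sigma> V. is_svd Z U \<sigma> V \<and> X = U * diag_of_list (map ystar \<sigma>) * V\<^sup>T))"

end

theory Submission
  imports Defs "Jordan_Normal_Form.Spectral_Radius"
begin

text \<open>Mirsky's inequality \<open>\<Sum>\<^sub>i (\<sigma>\<^sub>i(X) - \<sigma>\<^sub>i(Z))\<^sup>2 \<le> \<parallel>X - Z\<parallel>\<^sup>2\<close> reduces the matrix problem to the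
  scalar ones, so \<open>prox Z = U Diag(y\<^sup>*(\<sigma>)) V\<^sup>T\<close>.  Interpolating \<open>y\<^sup>*\<close> by an odd polynomial \<open>f\<close> on the finitely
  many singular values involved turns this into \<open>f(Z) = \<Sum>\<^sub>j c\<^sub>j Z (Z\<^sup>T Z)\<^sup>j\<close>, which refers to no
  singular value decomposition.  Split \<open>Z = Z\<^sub>1 + Z\<^sub>2\<close> into the parts above and below the threshold:
  \<open>Q Q\<^sup>T Z\<^sub>1 = Z\<^sub>1\<close>, so \<open>Q\<^sup>T Z\<^sub>1\<close> and \<open>Q\<^sup>T Z\<^sub>2\<close> are again mutually orthogonal on both sides, and \<open>f\<close> is
  additive on such sums.  Now \<open>Q f(Q\<^sup>T Z\<^sub>1) = f(Z\<^sub>1)\<close>, while \<open>f\<close> kills both \<open>Z\<^sub>2\<close> and \<open>Q\<^sup>T Z\<^sub>2\<close>, whose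
  singular values are at most \<open>\<gamma>\<close>.\<close>

unbundle no inner_syntax

section \<open>Existence of the singular value decomposition\<close>

lemma real_scalar_prod_self_ge_0: "(x :: real vec) \<bullet> x \<ge> 0"
  by (simp add: scalar_prod_def sum_nonneg)

lemma real_scalar_prod_self_eq_0:
  assumes "(x :: real vec) \<in> carrier_vec n"
  shows "x \<bullet> x = 0 \<longleftrightarrow> x = 0\<^sub>v n"
  using assms by (auto simp: scalar_prod_def sum_nonneg_eq_0_iff intro!: eq_vecI)

text \<open>Over the complex numbers the spectrum is non-empty. For an eigenvector
  \<open>z = x + i y\<close>, symmetry of \<open>S\<close> forces
  \<open>Im k * (x \<bullet> x + y \<bullet> y) = 0\<close>, so the eigenvalue is real and whichever
  of \<open>x\<close>, \<open>y\<close> is nonzero is a real eigenvector, which is then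
  normalized.\<close>

lemma real_symmetric_unit_eigenvector:
  fixes S :: "real mat"
  assumes S: "S \<in> carrier_mat n n" and sym: "S\<^sup>T = S" and n: "n > 0"
  obtains v k where "v \<in> carrier_vec n" "v \<bullet> v = 1" "S *\<^sub>v v = k \<cdot>\<^sub>v v"
proof -
  let ?C = "map_mat complex_of_real S"
  have C: "?C \<in> carrier_mat n n" using S by simp
  from spectrum_non_empty[OF C n] obtain k z where "eigenvector ?C z k"
    unfolding spectrum_def eigenvalue_def by auto
  then have z: "z \<in> carrier_vec n" "z \<noteq> 0\<^sub>v n" and eig: "?C *\<^sub>v z = k \<cdot>\<^sub>v z"
    using C unfolding eigenvector_def by auto
  define x where "x = map_vec Re z"
  define y where "y = map_vec Im z"
  have x: "x \<in> carrier_vec n" and y: "y \<in> carrier_vec n" using z by (auto simp: x_def y_def)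
  have row: "(\<Sum>j = 0..<n. complex_of_real (S $$ (i, j)) * z $ j) = k * z $ i" if "i < n" for i
    using arg_cong[OF eig, of "\<lambda>w. w $ i"] that S z by (simp add: scalar_prod_def)
  have Sx: "S *\<^sub>v x = Re k \<cdot>\<^sub>v x - Im k \<cdot>\<^sub>v y"
  proof (rule eq_vecI)
    fix i assume i: "i < dim_vec (Re k \<cdot>\<^sub>v x - Im k \<cdot>\<^sub>v y)"
    then have i: "i < n" using y by simp
    show "(S *\<^sub>v x) $ i = (Re k \<cdot>\<^sub>v x - Im k \<cdot>\<^sub>v y) $ i"
      using arg_cong[OF row[OF i], of Re] i S z by (simp add: scalar_prod_def x_def y_def)
  qed (use S y in auto)
  have Sy: "S *\<^sub>v y = Re k \<cdot>\<^sub>v y + Im k \<cdot>\<^sub>v x"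
  proof (rule eq_vecI)
    fix i assume i: "i < dim_vec (Re k \<cdot>\<^sub>v y + Im k \<cdot>\<^sub>v x)"
    then have i: "i < n" using x by simp
    show "(S *\<^sub>v y) $ i = (Re k \<cdot>\<^sub>v y + Im k \<cdot>\<^sub>v x) $ i"
      using arg_cong[OF row[OF i], of Im] i S z by (simp add: scalar_prod_def x_def y_def)
  qed (use S x in auto)
  have "(S *\<^sub>v x) \<bullet> y = x \<bullet> (S *\<^sub>v y)"
    using transpose_vec_mult_scalar[OF S y x] sym by simp
  then have "Im k * (x \<bullet> x + y \<bullet> y) = 0"
    unfolding Sx Sy using x y
    by (simp add: minus_scalar_prod_distrib[of _ n] scalar_prod_add_distrib[of _ n] algebra_simps)
  moreover have "x \<noteq> 0\<^sub>v n \<or> y \<noteq> 0\<^sub>v n"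
  proof (rule ccontr)
    assume "\<not> ?thesis"
    then have "z $ i = 0" if "i < n" for i
      using that z by (auto simp: x_def y_def complex_eq_iff vec_eq_iff)
    then show False using z by (auto intro: eq_vecI)
  qed
  ultimately have im: "Im k = 0"
    using real_scalar_prod_self_ge_0[of x] real_scalar_prod_self_ge_0[of y]
      real_scalar_prod_self_eq_0[OF x] real_scalar_prod_self_eq_0[OF y]
    by (auto simp: add_nonneg_eq_0_iff)
  obtain w where w: "w \<in> carrier_vec n" "w \<noteq> 0\<^sub>v n" "S *\<^sub>v w = Re k \<cdot>\<^sub>v w"
  proof (cases "x = 0\<^sub>v n")
    case True
    then show ?thesis using that[of y] \<open>x \<noteq> 0\<^sub>v n \<or> y \<noteq> 0\<^sub>v n\<close> y Sy im
      by (auto simp: vec_eq_iff)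
  next
    case False
    then show ?thesis using that[of x] x y Sx im by (auto simp: vec_eq_iff)
  qed
  define c where "c = 1 / sqrt (w \<bullet> w)"
  have pos: "w \<bullet> w > 0"
    using real_scalar_prod_self_ge_0[of w] real_scalar_prod_self_eq_0[OF w(1)] w(2) by simp
  show ?thesis
  proof (rule that[of "c \<cdot>\<^sub>v w" "Re k"])
    show "(c \<cdot>\<^sub>v w) \<bullet> (c \<cdot>\<^sub>v w) = 1"
      using pos w(1) by (simp add: c_def field_simps)
    show "S *\<^sub>v (c \<cdot>\<^sub>v w) = Re k \<cdot>\<^sub>v (c \<cdot>\<^sub>v w)"
      using w S by (simp add: mult_mat_vec smult_smult_assoc mult.commute)
  qed (use w in auto)
qed

text \<open>The Householder reflection along \<open>w = v - unit_vec n 0\<close> is orthogonal and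
  maps the first unit vector to \<open>v\<close>. For \<open>v = unit_vec n 0\<close> it
  degenerates, and the identity takes its place.\<close>

lemma orthogonal_mat_with_first_col:
  fixes v :: "real vec"
  assumes v: "v \<in> carrier_vec n" and unit: "v \<bullet> v = 1" and n: "0 < n"
  obtains H where "H \<in> carrier_mat n n" "H\<^sup>T * H = 1\<^sub>m n" "col H 0 = v"
proof (cases "v = unit_vec n 0")
  case True
  then show ?thesis using that[of "1\<^sub>m n"] n by simp
next
  case False
  define w where "w = v - unit_vec n 0"
  have w: "w \<in> carrier_vec n" using v by (simp add: w_def)
  have "w \<noteq> 0\<^sub>v n"
  proof
    assume "w = 0\<^sub>v n"
    then have "v = unit_vec n 0" using v by (auto simp: w_def vec_eq_iff)
    then show False using False by simp
  qed
  then have ww: "w \<bullet> w \<noteq> 0" using real_scalar_prod_self_eq_0[OF w] by simp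
  \<comment> \<open>Holds because \<open>v\<close> and the first unit vector both have length 1. It
    gives \<open>c * w $ 0 = - 1\<close>, so the first column of \<open>H\<close> is
    \<open>unit_vec n 0 + w = v\<close>.\<close>
  have ww2: "w \<bullet> w = - 2 * (w $ 0)"
    using v unit n by (simp add: w_def minus_scalar_prod_distrib[of _ n] scalar_prod_minus_distrib[of _ n])
  define c where "c = 2 / (w \<bullet> w)"
  define H where "H = mat n n (\<lambda>(i, j). (if i = j then 1 else 0) - c * (w $ i * w $ j))"
  have "H\<^sup>T * H = 1\<^sub>m n"
  proof (rule eq_matI)
    fix i j assume "i < dim_row (1\<^sub>m n :: real mat)" "j < dim_col (1\<^sub>m n :: real mat)"
    then have ij: "i < n" "j < n" by auto
    have "(H\<^sup>T * H) $$ (i, j) = (\<Sum>l = 0..<n. ((if l = i then 1 else 0) - c * (w $ l * w $ i))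
        * ((if l = j then 1 else 0) - c * (w $ l * w $ j)))"
      using ij by (simp add: H_def scalar_prod_def)
    also have "\<dots> = (\<Sum>l = 0..<n. (if l = i then (if l = j then 1 else 0) else 0)
        - (if l = i then c * (w $ l * w $ j) else 0) - (if l = j then c * (w $ l * w $ i) else 0)
        + c * c * (w $ i * w $ j) * (w $ l * w $ l))"
      by (rule sum.cong) (auto simp: algebra_simps)
    also have "\<dots> = (if i = j then 1 else 0) - 2 * c * (w $ i * w $ j)
        + c * c * (w $ i * w $ j) * (w \<bullet> w)"
      using ij w by (simp add: sum.distrib sum_subtractf sum_distrib_left[symmetric] scalar_prod_def)
    also have "\<dots> = (if i = j then 1 else 0)"
      using ww by (simp add: c_def field_simps)
    finally show "(H\<^sup>T * H) $$ (i, j) = 1\<^sub>m n $$ (i, j)" using ij by simp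
  qed (auto simp: H_def)
  moreover have "col H 0 = v"
  proof (rule eq_vecI)
    fix i assume "i < dim_vec v"
    then have i: "i < n" using v by simp
    have "c * w $ 0 = - 1" using ww ww2 by (simp add: c_def field_simps)
    then have *: "c * (w $ i * w $ 0) = - (w $ i)" by (metis mult.left_commute mult_minus1_right)
    show "col H 0 $ i = v $ i" using i n v * unfolding H_def by (auto simp: w_def)
  qed (use v in \<open>auto simp: H_def\<close>)
  ultimately show ?thesis using that[of H] by (auto simp: H_def)
qed

text \<open>The eigenvalue \<open>k\<close> is the squared length of \<open>A *\<^sub>v v\<close>,
  hence positive when nonzero. Then \<open>s\<close> is its square root and \<open>u\<close> is
  \<open>A *\<^sub>v v\<close> divided by \<open>s\<close>.\<close>

lemma singular_pair_of_gram_eigenvector: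
  fixes A :: "real mat"
  assumes A: "A \<in> carrier_mat m n" and v: "v \<in> carrier_vec n" "v \<bullet> v = 1"
    and eig: "(A\<^sup>T * A) *\<^sub>v v = k \<cdot>\<^sub>v v" and k: "k \<noteq> 0"
  obtains u s where "u \<in> carrier_vec m" "u \<bullet> u = 1" "s \<ge> 0"
    "A *\<^sub>v v = s \<cdot>\<^sub>v u" "A\<^sup>T *\<^sub>v u = s \<cdot>\<^sub>v v"
proof -
  define x where "x = A *\<^sub>v v"
  have x: "x \<in> carrier_vec m" using A v by (auto simp: x_def)
  have Ax: "A\<^sup>T *\<^sub>v x = k \<cdot>\<^sub>v v" using eig A v by (simp add: x_def)
  have xx: "x \<bullet> x = k"
    using transpose_vec_mult_scalar[OF A v(1) x] Ax v A by (simp add: x_def)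
  then have kpos: "k > 0" using k real_scalar_prod_self_ge_0[of x] by simp
  define s where "s = sqrt k"
  have s: "s > 0" "s * s = k" using kpos by (auto simp: s_def)
  show ?thesis
  proof (rule that[of "(1 / s) \<cdot>\<^sub>v x" s])
    show "((1 / s) \<cdot>\<^sub>v x) \<bullet> ((1 / s) \<cdot>\<^sub>v x) = 1" using x xx s kpos by (simp add: field_simps)
    show "A *\<^sub>v v = s \<cdot>\<^sub>v ((1 / s) \<cdot>\<^sub>v x)" using s by (simp add: x_def smult_smult_assoc)
    show "A\<^sup>T *\<^sub>v ((1 / s) \<cdot>\<^sub>v x) = s \<cdot>\<^sub>v v"
      using s x A by (simp add: mult_mat_vec[of _ n m] Ax smult_smult_assoc)
        (simp flip: s(2))
  qed (use x s in auto)
qed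

text \<open>The deflation below works with a pair for any singular value, not only the largest. A
  nonzero eigenvalue of either Gram matrix yields one. If both eigenvalues found are 0, then
  \<open>A *\<^sub>v v\<close> and \<open>A\<^sup>T *\<^sub>v u\<close> vanish, and
  \<open>u\<close>, \<open>v\<close> form a pair with \<open>s = 0\<close>.\<close>

lemma singular_pair_exists:
  fixes A :: "real mat"
  assumes A: "A \<in> carrier_mat m n" and m: "0 < m" and n: "0 < n"
  obtains u v s where "u \<in> carrier_vec m" "u \<bullet> u = 1" "v \<in> carrier_vec n" "v \<bullet> v = 1" "s \<ge> 0"
    "A *\<^sub>v v = s \<cdot>\<^sub>v u" "A\<^sup>T *\<^sub>v u = s \<cdot>\<^sub>v v"
proof -
  have At: "A\<^sup>T \<in> carrier_mat n m" using A by simp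
  obtain v k where v: "v \<in> carrier_vec n" "v \<bullet> v = 1" "(A\<^sup>T * A) *\<^sub>v v = k \<cdot>\<^sub>v v"
    using real_symmetric_unit_eigenvector[of "A\<^sup>T * A" n] A n by (auto simp: transpose_mult[of _ n m])
  obtain u l where u: "u \<in> carrier_vec m" "u \<bullet> u = 1" "(A * A\<^sup>T) *\<^sub>v u = l \<cdot>\<^sub>v u"
    using real_symmetric_unit_eigenvector[of "A * A\<^sup>T" m] A m by (auto simp: transpose_mult[of _ m n])
  consider "k \<noteq> 0" | "l \<noteq> 0" | "k = 0" "l = 0" by blast
  then show ?thesis
  proof cases
    case 1
    from singular_pair_of_gram_eigenvector[OF A v 1] show ?thesis using that v by metis
  next
    case 2
    have u3: "((A\<^sup>T)\<^sup>T * A\<^sup>T) *\<^sub>v u = l \<cdot>\<^sub>v u" using u(3) by simp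
    from singular_pair_of_gram_eigenvector[OF At u(1,2) u3 2] show ?thesis
      using that u by (metis transpose_transpose)
  next
    case 3
    have Av: "A *\<^sub>v v \<in> carrier_vec m" and Au: "A\<^sup>T *\<^sub>v u \<in> carrier_vec n" using A v u by auto
    have "A\<^sup>T *\<^sub>v (A *\<^sub>v v) = 0\<^sub>v n" using v A 3 by (auto simp: vec_eq_iff)
    then have "A *\<^sub>v v = 0\<^sub>v m"
      using transpose_vec_mult_scalar[OF A v(1) Av] v(1) real_scalar_prod_self_eq_0[OF Av] by simp
    moreover have "A *\<^sub>v (A\<^sup>T *\<^sub>v u) = 0\<^sub>v m" using u A 3 by (auto simp: vec_eq_iff)
    then have "A\<^sup>T *\<^sub>v u = 0\<^sub>v n"
      using transpose_vec_mult_scalar[OF At u(1) Au] u(1) real_scalar_prod_self_eq_0[OF Au] by simp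
    ultimately show ?thesis using that[of u v 0] u v by (auto simp: vec_eq_iff)
  qed
qed

lemma mult_block_diag_mat:
  fixes A :: "'a :: comm_ring_1 mat"
  assumes "A \<in> carrier_mat a b" "B \<in> carrier_mat c d" "C \<in> carrier_mat b e" "D \<in> carrier_mat d f"
  shows "four_block_mat A (0\<^sub>m a d) (0\<^sub>m c b) B * four_block_mat C (0\<^sub>m b f) (0\<^sub>m d e) D =
    four_block_mat (A * C) (0\<^sub>m a f) (0\<^sub>m c e) (B * D)"
  using assms by (subst mult_four_block_mat[of _ a b _ d _ c _ _ e _ f]) auto

text \<open>Enlarges the singular vectors of the deflated block: bordering by a 1 and then
  multiplying by an orthogonal matrix both preserve orthonormal columns.\<close>

lemma orthonormal_cols_four_block:
  fixes U :: "real mat"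
  assumes H: "H \<in> carrier_mat (Suc m) (Suc m)" "H\<^sup>T * H = 1\<^sub>m (Suc m)"
    and U: "U \<in> carrier_mat m p" "U\<^sup>T * U = 1\<^sub>m p"
  defines "F \<equiv> four_block_mat (1\<^sub>m 1) (0\<^sub>m 1 p) (0\<^sub>m m 1) U"
  shows "H * F \<in> carrier_mat (Suc m) (Suc p)" "(H * F)\<^sup>T * (H * F) = 1\<^sub>m (Suc p)"
proof -
  have F: "F \<in> carrier_mat (Suc m) (Suc p)"
    using U four_block_carrier_mat[of "1\<^sub>m 1" 1 1 U m p] by (simp add: F_def)
  show "H * F \<in> carrier_mat (Suc m) (Suc p)" using H F by simp
  have "F\<^sup>T * F = four_block_mat (1\<^sub>m 1) (0\<^sub>m 1 p) (0\<^sub>m p 1) (1\<^sub>m p)"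
    unfolding F_def using U
    by (simp add: transpose_four_block_mat[of _ 1 1 _ p _ m] mult_four_block_mat[of _ 1 1 _ m _ p _ _ 1 _ p])
  then have FF: "F\<^sup>T * F = 1\<^sub>m (Suc p)" by simp
  have "(H * F)\<^sup>T * (H * F) = (F\<^sup>T * H\<^sup>T) * (H * F)"
    using transpose_mult[OF H(1) F] by simp
  also have "\<dots> = F\<^sup>T * (H\<^sup>T * (H * F))"
    using H(1) F by (intro assoc_mult_mat[of _ _ "Suc m" _ "Suc m" _ "Suc p"]) auto
  also have "H\<^sup>T * (H * F) = (H\<^sup>T * H) * F"
    using H(1) F by (intro assoc_mult_mat[symmetric, of _ _ "Suc m" _ "Suc m" _ "Suc p"]) auto
  also have "F\<^sup>T * \<dots> = 1\<^sub>m (Suc p)" unfolding H(2) using F FF by simp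
  finally show "(H * F)\<^sup>T * (H * F) = 1\<^sub>m (Suc p)" .
qed

text \<open>Deflation: a singular pair \<open>u\<close>, \<open>v\<close> is completed to orthogonal
  matrices \<open>H\<close>, \<open>G\<close>. Then \<open>H\<^sup>T * (A * G)\<close> is block
  diagonal with the entry \<open>s\<close> and a smaller block \<open>B\<close>, which the induction
  hypothesis decomposes.\<close>

lemma unsorted_svd_exists:
  fixes A :: "real mat"
  assumes "A \<in> carrier_mat m n"
  shows "\<exists>U d V. U \<in> carrier_mat m (min m n) \<and> U\<^sup>T * U = 1\<^sub>m (min m n) \<and>
    V \<in> carrier_mat n (min m n) \<and> V\<^sup>T * V = 1\<^sub>m (min m n) \<and>
    (\<forall>i. 0 \<le> d i) \<and> A = U * mat_diag (min m n) d * V\<^sup>T"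
  using assms
proof (induction m arbitrary: n A)
  case 0
  then show ?case
    by (intro exI[of _ "0\<^sub>m 0 0"] exI[of _ "\<lambda>_. 0"] exI[of _ "0\<^sub>m n 0"]) (auto intro!: eq_matI)
next
  case (Suc m n')
  show ?case
  proof (cases n')
    case 0
    then show ?thesis using Suc.prems
      by (intro exI[of _ "0\<^sub>m (Suc m) 0"] exI[of _ "\<lambda>_. 0"] exI[of _ "0\<^sub>m 0 0"]) (auto intro!: eq_matI)
  next
    case n': (Suc n)
    define p where "p = min m n"
    have A: "A \<in> carrier_mat (Suc m) (Suc n)" using Suc.prems n' by simp
    from singular_pair_exists[OF A] obtain u v s where
      u: "u \<in> carrier_vec (Suc m)" "u \<bullet> u = 1" and v: "v \<in> carrier_vec (Suc n)" "v \<bullet> v = 1"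
      and s: "s \<ge> 0" and Av: "A *\<^sub>v v = s \<cdot>\<^sub>v u" and Au: "A\<^sup>T *\<^sub>v u = s \<cdot>\<^sub>v v" by auto
    from orthogonal_mat_with_first_col[OF u] obtain H where
      H: "H \<in> carrier_mat (Suc m) (Suc m)" "H\<^sup>T * H = 1\<^sub>m (Suc m)" and Hu: "col H 0 = u" by auto
    from orthogonal_mat_with_first_col[OF v] obtain G where
      G: "G \<in> carrier_mat (Suc n) (Suc n)" "G\<^sup>T * G = 1\<^sub>m (Suc n)" and Gv: "col G 0 = v" by auto
    have HH: "H * H\<^sup>T = 1\<^sub>m (Suc m)" and GG: "G * G\<^sup>T = 1\<^sub>m (Suc n)"
      using mat_mult_left_right_inverse[OF _ H(1) H(2)] mat_mult_left_right_inverse[OF _ G(1) G(2)] H G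
      by auto
    define M where "M = H\<^sup>T * (A * G)"
    have M: "M \<in> carrier_mat (Suc m) (Suc n)" using H A G by (simp add: M_def)
    \<comment> \<open>The first column is cleared by \<open>Av\<close>, and the first row below by
      \<open>Au\<close>; this is why both equations of a singular pair are required.\<close>
    have M0: "M $$ (i, 0) = (if i = 0 then s else 0)" if i: "i < Suc m" for i
    proof -
      have "col (A * G) 0 = s \<cdot>\<^sub>v u"
        using col_mult2[OF A G(1)] Gv Av by simp
      then have "M $$ (i, 0) = s * (col H i \<bullet> col H 0)"
        using i H A G u Hu by (simp add: M_def)
      also have "col H i \<bullet> col H 0 = (H\<^sup>T * H) $$ (i, 0)" using H(1) i by simp
      finally show ?thesis unfolding H(2) using i by simp
    qed
    have M0': "M $$ (0, j) = (if j = 0 then s else 0)" if j: "j < Suc n" for j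
    proof -
      have Gj: "col G j \<in> carrier_vec (Suc n)" using G j by auto
      have "M $$ (0, j) = u \<bullet> (A *\<^sub>v col G j)"
        using j H A G Hu col_mult2[OF A G(1) j] by (simp add: M_def)
      also have "\<dots> = s * (col G 0 \<bullet> col G j)"
        using transpose_vec_mult_scalar[OF A Gj u(1)] Au v Gj Gv by simp
      also have "col G 0 \<bullet> col G j = (G\<^sup>T * G) $$ (0, j)" using G(1) j by simp
      finally show ?thesis unfolding G(2) using j by simp
    qed
    define B where "B = mat m n (\<lambda>(i, j). M $$ (Suc i, Suc j))"
    have B: "B \<in> carrier_mat m n" by (simp add: B_def)
    from Suc.IH[OF B] obtain U d V where
      U: "U \<in> carrier_mat m p" "U\<^sup>T * U = 1\<^sub>m p" and V: "V \<in> carrier_mat n p" "V\<^sup>T * V = 1\<^sub>m p"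
      and d: "\<And>i. 0 \<le> d i" and Bd: "B = U * mat_diag p d * V\<^sup>T"
      unfolding p_def by blast
    \<comment> \<open>The value split off gets index 0, and those of the smaller block move up by
      one.\<close>
    define e where "e = (\<lambda>i. case i of 0 \<Rightarrow> s | Suc j \<Rightarrow> d j)"
    define FU where "FU = four_block_mat (1\<^sub>m 1) (0\<^sub>m 1 p) (0\<^sub>m m 1) U"
    define FV where "FV = four_block_mat (1\<^sub>m 1) (0\<^sub>m 1 p) (0\<^sub>m n 1) V"
    have FU: "FU \<in> carrier_mat (Suc m) (Suc p)"
      using U four_block_carrier_mat[of "1\<^sub>m 1" 1 1 U m p] by (simp add: FU_def)
    have FV: "FV \<in> carrier_mat (Suc n) (Suc p)"
      using V four_block_carrier_mat[of "1\<^sub>m 1" 1 1 V n p] by (simp add: FV_def)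
    have De: "mat_diag (Suc p) e = four_block_mat (mat 1 1 (\<lambda>_. s)) (0\<^sub>m 1 p) (0\<^sub>m p 1) (mat_diag p d)"
      by (rule eq_matI) (auto simp: mat_diag_def e_def split: nat.splits)
    have 1: "FU * mat_diag (Suc p) e
        = four_block_mat (mat 1 1 (\<lambda>_. s)) (0\<^sub>m 1 p) (0\<^sub>m m 1) (U * mat_diag p d)"
      unfolding De FU_def by (subst mult_block_diag_mat) (use U in auto)
    have 2: "FV\<^sup>T = four_block_mat (1\<^sub>m 1) (0\<^sub>m 1 n) (0\<^sub>m p 1) V\<^sup>T"
      unfolding FV_def by (subst transpose_four_block_mat) (use V in auto)
    have "U * mat_diag p d \<in> carrier_mat m p" using U by (auto intro!: mult_carrier_mat)
    then have "FU * mat_diag (Suc p) e * FV\<^sup>T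
        = four_block_mat (mat 1 1 (\<lambda>_. s)) (0\<^sub>m 1 n) (0\<^sub>m m 1) (U * mat_diag p d * V\<^sup>T)"
      unfolding 1 2 by (subst mult_block_diag_mat) (use V in auto)
    also have "\<dots> = M"
      unfolding Bd[symmetric] using M M0 M0'
      by (intro eq_matI) (auto simp: B_def)
    finally have Md: "M = FU * mat_diag (Suc p) e * FV\<^sup>T" ..
    have "H * M = (H * H\<^sup>T) * (A * G)"
      unfolding M_def by (rule assoc_mult_mat[symmetric, of _ "Suc m" "Suc m" _ "Suc m" _ "Suc n"]) (use H A G in auto)
    also have "\<dots> = A * G" unfolding HH using A G by simp
    also have "\<dots> * G\<^sup>T = A * (G * G\<^sup>T)"
      by (rule assoc_mult_mat[of _ "Suc m" "Suc n" _ "Suc n" _ "Suc n"]) (use A G in auto)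
    also have "\<dots> = A" unfolding GG using A by simp
    finally have "A = H * (FU * mat_diag (Suc p) e * FV\<^sup>T) * G\<^sup>T" unfolding Md ..
    also have "H * (FU * mat_diag (Suc p) e * FV\<^sup>T) = H * (FU * mat_diag (Suc p) e) * FV\<^sup>T"
      by (rule assoc_mult_mat[symmetric, of _ "Suc m" "Suc m" _ "Suc p" _ "Suc n"]) (use H FU FV in auto)
    also have "H * (FU * mat_diag (Suc p) e) = (H * FU) * mat_diag (Suc p) e"
      by (rule assoc_mult_mat[symmetric, of _ "Suc m" "Suc m" _ "Suc p" _ "Suc p"]) (use H FU in auto)
    also have "(H * FU) * mat_diag (Suc p) e * FV\<^sup>T * G\<^sup>T = (H * FU) * mat_diag (Suc p) e * (FV\<^sup>T * G\<^sup>T)"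
      by (rule assoc_mult_mat[of _ "Suc m" "Suc p" _ "Suc n" _ "Suc n"]) (use H FU FV G in \<open>auto intro!: mult_carrier_mat\<close>)
    also have "FV\<^sup>T * G\<^sup>T = (G * FV)\<^sup>T" using transpose_mult[OF G(1) FV] by simp
    finally have Ad: "A = (H * FU) * mat_diag (Suc p) e * (G * FV)\<^sup>T" .
    have "min (Suc m) n' = Suc p" using n' by (simp add: p_def)
    moreover have "\<forall>i. 0 \<le> e i" using s d by (auto simp: e_def split: nat.splits)
    ultimately show ?thesis
      using Ad orthonormal_cols_four_block[OF H U] orthonormal_cols_four_block[OF G V] n'
      unfolding FU_def FV_def by metis
  qed
qed

section \<open>Entrywise formulas and ordering of the singular values\<close>

lemma diag_conj_entry:
  fixes A C :: "real mat"
  assumes "A \<in> carrier_mat m p" "C \<in> carrier_mat n p" "i < m" "j < n"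
  shows "(A * mat_diag p d * C\<^sup>T) $$ (i, j) = (\<Sum>l<p. A $$ (i, l) * d l * C $$ (j, l))"
  using assms by (simp add: mat_diag_mult_right[of _ m] scalar_prod_def atLeast0LessThan)

lemma orthonormal_cols_iff:
  fixes U :: "real mat"
  assumes U: "U \<in> carrier_mat m p"
  shows "U\<^sup>T * U = 1\<^sub>m p \<longleftrightarrow>
    (\<forall>i<p. \<forall>j<p. (\<Sum>l<m. U $$ (l, i) * U $$ (l, j)) = (if i = j then 1 else 0))"
proof -
  have "(U\<^sup>T * U) $$ (i, j) = (\<Sum>l<m. U $$ (l, i) * U $$ (l, j))" if "i < p" "j < p" for i j
    using that U by (simp add: scalar_prod_def atLeast0LessThan)
  then show ?thesis using U by (auto simp: mat_eq_iff)
qed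

text \<open>A permutation \<open>xs\<close> that puts the values in non-increasing order, hence the
  sort key \<open>- d i\<close>, is applied to the values and to the columns of both factors alike.
  This only reindexes the sum that gives each entry of \<open>A\<close>.\<close>

lemma svd_exists: "\<exists>U \<sigma> V. is_svd A U \<sigma> V"
proof -
  define m where "m = dim_row A"
  define n where "n = dim_col A"
  define p where "p = min m n"
  have A: "A \<in> carrier_mat m n" by (auto simp: m_def n_def)
  from unsorted_svd_exists[OF A] obtain U d V where
    U: "U \<in> carrier_mat m p" "U\<^sup>T * U = 1\<^sub>m p" and V: "V \<in> carrier_mat n p" "V\<^sup>T * V = 1\<^sub>m p"
    and d: "\<And>i. 0 \<le> d i" and Ad: "A = U * mat_diag p d * V\<^sup>T"
    unfolding p_def by blast
  define xs where "xs = sort_key (\<lambda>i. - d i) [0..<p]"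
  have len: "length xs = p" by (simp add: xs_def)
  have bij: "bij_betw (\<lambda>i. xs ! i) {..<p} {..<p}"
    by (rule bij_betw_nth) (auto simp: xs_def)
  then have lt: "xs ! i < p" if "i < p" for i using that by (auto simp: bij_betw_def)
  have inj: "xs ! i = xs ! j \<longleftrightarrow> i = j" if "i < p" "j < p" for i j
    using that bij by (auto simp: bij_betw_def inj_on_def)
  define P where "P X q = mat q p (\<lambda>(i, j). X $$ (i, xs ! j))" for X :: "real mat" and q
  have P: "P X q \<in> carrier_mat q p" for X q by (simp add: P_def)
  have orth: "(P X q)\<^sup>T * P X q = 1\<^sub>m p" if "X \<in> carrier_mat q p" "X\<^sup>T * X = 1\<^sub>m p" for X q
    using that unfolding orthonormal_cols_iff[OF P] orthonormal_cols_iff[OF that(1)]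
    by (auto simp: P_def lt inj)
  have eq: "A = P U m * diag_of_list (map d xs) * (P V n)\<^sup>T"
  proof (rule eq_matI)
    fix i j
    assume "i < dim_row (P U m * diag_of_list (map d xs) * (P V n)\<^sup>T)"
      "j < dim_col (P U m * diag_of_list (map d xs) * (P V n)\<^sup>T)"
    then have i: "i < m" and j: "j < n" by (auto simp: P_def)
    have "A $$ (i, j) = (\<Sum>l<p. U $$ (i, l) * d l * V $$ (j, l))"
      unfolding Ad by (rule diag_conj_entry[OF U(1) V(1) i j])
    also have "\<dots> = (\<Sum>l<p. U $$ (i, xs ! l) * d (xs ! l) * V $$ (j, xs ! l))"
      by (rule sum.reindex_bij_betw[OF bij, symmetric])
    also have "\<dots> = (\<Sum>l<p. P U m $$ (i, l) * (map d xs ! l) * P V n $$ (j, l))"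
      by (rule sum.cong) (use i j len in \<open>auto simp: P_def\<close>)
    also have "\<dots> = (P U m * diag_of_list (map d xs) * (P V n)\<^sup>T) $$ (i, j)"
      unfolding diag_of_list_def length_map len by (rule diag_conj_entry[OF P P i j, symmetric])
    finally show "A $$ (i, j) = (P U m * diag_of_list (map d xs) * (P V n)\<^sup>T) $$ (i, j)" .
  qed (use A in \<open>auto simp: P_def\<close>)
  have "sorted (map (\<lambda>i. - d i) xs)" unfolding xs_def by (rule sorted_sort_key)
  then have "sorted_wrt (\<ge>) (map d xs)" by (simp add: sorted_wrt_map)
  then have "is_svd A (P U m) (map d xs) (P V n)"
    unfolding is_svd_def Let_def m_def[symmetric] n_def[symmetric] p_def[symmetric]
    using eq P orth U V d len by (auto simp: P_def)
  then show ?thesis by blast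
qed

section \<open>Mirsky's inequality and uniqueness of the singular values\<close>

text \<open>Summation by parts: the weighted sum of \<open>b - a\<close> combines its partial sums,
  which are non-negative, with the decrements of \<open>t\<close> and the last weight as
  coefficients, and these are non-negative too.\<close>

lemma sorted_weighted_sum_mono:
  fixes t a b :: "nat \<Rightarrow> real"
  assumes nonneg: "\<And>i. i < p \<Longrightarrow> 0 \<le> t i"
    and anti: "\<And>i j. i \<le> j \<Longrightarrow> j < p \<Longrightarrow> t j \<le> t i"
    and partial: "\<And>k. k \<le> p \<Longrightarrow> (\<Sum>i<k. a i) \<le> (\<Sum>i<k. b i)"
  shows "(\<Sum>i<p. t i * a i) \<le> (\<Sum>i<p. t i * b i)"
proof -
  define c where "c i = b i - a i" for i
  have C: "0 \<le> (\<Sum>i<k. c i)" if "k \<le> p" for k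
    using partial[OF that] by (simp add: c_def sum_subtractf)
  \<comment> \<open>Summation by parts in inductive form: replacing all weights up to index
    \<open>k\<close> by the smallest of them does not increase the sum.\<close>
  have step: "t k * (\<Sum>i<Suc k. c i) \<le> (\<Sum>i<Suc k. t i * c i)" if "k < p" for k
    using that
  proof (induction k)
    case (Suc k)
    have "t (Suc k) * (\<Sum>i<Suc k. c i) \<le> t k * (\<Sum>i<Suc k. c i)"
      by (rule mult_right_mono) (use anti[of k "Suc k"] C[of "Suc k"] Suc.prems in auto)
    also have "\<dots> \<le> (\<Sum>i<Suc k. t i * c i)" using Suc by simp
    finally show ?case by (simp add: distrib_left)
  qed simp
  have "0 \<le> (\<Sum>i<p. t i * c i)"
  proof (cases p)
    case (Suc k)
    have "0 \<le> t k * (\<Sum>i<Suc k. c i)" using nonneg[of k] C[of "Suc k"] Suc by simp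
    also have "\<dots> \<le> (\<Sum>i<Suc k. t i * c i)" using step[of k] Suc by simp
    finally show ?thesis using Suc by simp
  qed simp
  then show ?thesis by (simp add: c_def algebra_simps sum_subtractf)
qed

text \<open>The majorization argument is applied twice, with weights \<open>t\<close> over the rows
  and with weights \<open>s\<close> over the columns. This avoids decomposing \<open>w\<close> into
  permutation matrices.\<close>

lemma doubly_substochastic_rearrangement:
  fixes t s :: "nat \<Rightarrow> real" and w :: "nat \<Rightarrow> nat \<Rightarrow> real"
  assumes t: "\<And>i. i < p \<Longrightarrow> 0 \<le> t i" "\<And>i j. i \<le> j \<Longrightarrow> j < p \<Longrightarrow> t j \<le> t i"
    and s: "\<And>i. i < p \<Longrightarrow> 0 \<le> s i" "\<And>i j. i \<le> j \<Longrightarrow> j < p \<Longrightarrow> s j \<le> s i"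
    and w: "\<And>i j. i < p \<Longrightarrow> j < p \<Longrightarrow> 0 \<le> w i j"
    and rows: "\<And>i. i < p \<Longrightarrow> (\<Sum>j<p. w i j) \<le> 1"
    and cols: "\<And>j. j < p \<Longrightarrow> (\<Sum>i<p. w i j) \<le> 1"
  shows "(\<Sum>i<p. \<Sum>j<p. t i * s j * w i j) \<le> (\<Sum>i<p. t i * s i)"
proof -
  have "(\<Sum>i<p. t i * (\<Sum>j<p. s j * w i j)) \<le> (\<Sum>i<p. t i * s i)"
  proof (rule sorted_weighted_sum_mono[OF t])
    fix k assume k: "k \<le> p"
    have "(\<Sum>i<k. \<Sum>j<p. s j * w i j) = (\<Sum>j<p. s j * (\<Sum>i<k. w i j))"
      by (subst sum.swap) (simp add: sum_distrib_left)
    also have "\<dots> \<le> (\<Sum>j<p. s j * (if j < k then 1 else 0))"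
    proof (rule sorted_weighted_sum_mono[OF s])
      \<comment> \<open>The block of \<open>w\<close> with \<open>k\<close> rows and
        \<open>l\<close> columns has total at most \<open>l\<close> by the column sums and at most
        \<open>k\<close> by the row sums, while the indicator contributes exactly
        \<open>min l k\<close>.\<close>
      fix l assume l: "l \<le> p"
      have "(\<Sum>j<l. \<Sum>i<k. w i j) \<le> (\<Sum>j<l. 1)"
      proof (rule sum_mono)
        fix j assume "j \<in> {..<l}"
        then have j: "j < p" using l by auto
        have "(\<Sum>i<k. w i j) \<le> (\<Sum>i<p. w i j)"
          by (rule sum_mono2) (use k j w in auto)
        then show "(\<Sum>i<k. w i j) \<le> 1" using cols[OF j] by simp
      qed
      moreover have "(\<Sum>j<l. \<Sum>i<k. w i j) \<le> (\<Sum>i<k. 1)"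
        unfolding sum.swap[of _ "{..<k}"]
      proof (rule sum_mono)
        fix i assume "i \<in> {..<k}"
        then have i: "i < p" using k by auto
        have "(\<Sum>j<l. w i j) \<le> (\<Sum>j<p. w i j)"
          by (rule sum_mono2) (use l i w in auto)
        then show "(\<Sum>j<l. w i j) \<le> 1" using rows[OF i] by simp
      qed
      moreover have "(\<Sum>j<l. if j < k then 1 else 0 :: real) = real (min l k)"
      proof -
        have "{..<l} \<inter> {j. j < k} = {..<min l k}" by auto
        then show ?thesis by (simp add: sum.If_cases)
      qed
      ultimately show "(\<Sum>j<l. \<Sum>i<k. w i j) \<le> (\<Sum>j<l. if j < k then 1 else 0)"
        by (simp add: min_def)
    qed
    also have "\<dots> = (\<Sum>j<k. s j)"
    proof -
      have "{..<p} \<inter> {j. j < k} = {..<k}" using k by auto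
      then show ?thesis by (simp add: if_distrib[of "(*) _"] sum.If_cases)
    qed
    finally show "(\<Sum>i<k. \<Sum>j<p. s j * w i j) \<le> (\<Sum>i<k. s i)" .
  qed
  then show ?thesis by (simp add: sum_distrib_left mult.assoc)
qed

text \<open>The vector \<open>y\<close> is the orthogonal projection of \<open>x\<close> onto the
  columns of \<open>U\<close>. Its square norm and its inner product with \<open>x\<close> both
  equal the left-hand side, so the claim is that the square norm of \<open>x - y\<close> is
  non-negative.\<close>

lemma bessel_inequality_cols:
  fixes U :: "real mat" and x :: "nat \<Rightarrow> real"
  assumes U: "U \<in> carrier_mat m p" "U\<^sup>T * U = 1\<^sub>m p"
  shows "(\<Sum>j<p. (\<Sum>l<m. x l * U $$ (l, j))\<^sup>2) \<le> (\<Sum>l<m. (x l)\<^sup>2)"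
proof -
  define c where "c j = (\<Sum>l<m. x l * U $$ (l, j))" for j
  define y where "y l = (\<Sum>j<p. c j * U $$ (l, j))" for l
  have orth: "(\<Sum>l<m. U $$ (l, i) * U $$ (l, j)) = (if i = j then 1 else 0)" if "i < p" "j < p" for i j
    using U that by (simp add: orthonormal_cols_iff)
  have xy: "(\<Sum>l<m. x l * y l) = (\<Sum>j<p. (c j)\<^sup>2)"
  proof -
    have "(\<Sum>l<m. x l * y l) = (\<Sum>j<p. \<Sum>l<m. c j * (x l * U $$ (l, j)))"
      unfolding y_def sum_distrib_left by (subst sum.swap) (simp add: mult_ac)
    then show ?thesis by (simp add: sum_distrib_left[symmetric] c_def power2_eq_square)
  qed
  have yy: "(\<Sum>l<m. (y l)\<^sup>2) = (\<Sum>j<p. (c j)\<^sup>2)"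
  proof -
    have "(\<Sum>l<m. (y l)\<^sup>2) = (\<Sum>l<m. \<Sum>i<p. \<Sum>j<p. c i * c j * (U $$ (l, i) * U $$ (l, j)))"
      by (simp add: y_def power2_eq_square sum_product mult_ac)
    also have "\<dots> = (\<Sum>i<p. \<Sum>j<p. \<Sum>l<m. c i * c j * (U $$ (l, i) * U $$ (l, j)))"
      by (subst sum.swap, rule sum.cong[OF refl], rule sum.swap)
    also have "\<dots> = (\<Sum>i<p. \<Sum>j<p. c i * c j * (if i = j then 1 else 0))"
      by (intro sum.cong refl) (simp add: sum_distrib_left[symmetric] orth)
    also have "\<dots> = (\<Sum>i<p. (c i)\<^sup>2)"
      by (rule sum.cong) (auto simp: power2_eq_square if_distrib[of "(*) _"] cong: if_cong)
    finally show ?thesis .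
  qed
  have "0 \<le> (\<Sum>l<m. (x l - y l)\<^sup>2)" by (simp add: sum_nonneg)
  also have "\<dots> = (\<Sum>l<m. (x l)\<^sup>2) - 2 * (\<Sum>l<m. x l * y l) + (\<Sum>l<m. (y l)\<^sup>2)"
    by (simp add: power2_diff sum.distrib sum_subtractf sum_distrib_left mult_ac)
  finally show ?thesis using xy yy by (simp add: c_def)
qed

section \<open>Frobenius inner products of diagonal conjugations\<close>

lemma frobenius_norm_sq:
  assumes "A \<in> carrier_mat m n"
  shows "(frobenius_norm A)\<^sup>2 = (\<Sum>i<m. \<Sum>j<n. (A $$ (i, j))\<^sup>2)"
  using assms by (simp add: frobenius_norm_def sum_nonneg)

lemma frobenius_norm_diff_sq:
  assumes X: "X \<in> carrier_mat m n" and Z: "Z \<in> carrier_mat m n"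
  shows "(frobenius_norm (X - Z))\<^sup>2 = (frobenius_norm X)\<^sup>2
    - 2 * (\<Sum>i<m. \<Sum>j<n. X $$ (i, j) * Z $$ (i, j)) + (frobenius_norm Z)\<^sup>2"
proof -
  have "(frobenius_norm (X - Z))\<^sup>2 = (\<Sum>i<m. \<Sum>j<n. (X $$ (i, j) - Z $$ (i, j))\<^sup>2)"
    unfolding frobenius_norm_sq[OF minus_carrier_mat[OF Z]]
    by (intro sum.cong refl) (use X Z in simp)
  then show ?thesis
    unfolding frobenius_norm_sq[OF X] frobenius_norm_sq[OF Z]
    by (simp add: power2_diff sum.distrib sum_subtractf sum_distrib_left mult.assoc)
qed

text \<open>Reduces the inner product to overlaps between the left and between the right vectors.
  Equal factors give the norm; two different decompositions give the trace term of Mirsky's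
  inequality.\<close>

lemma frobenius_inner_diag_conj:
  fixes A C U V :: "real mat"
  assumes "A \<in> carrier_mat m p" "C \<in> carrier_mat n p" "U \<in> carrier_mat m p" "V \<in> carrier_mat n p"
  shows "(\<Sum>i<m. \<Sum>j<n. (A * mat_diag p t * C\<^sup>T) $$ (i, j) * (U * mat_diag p s * V\<^sup>T) $$ (i, j)) =
    (\<Sum>k<p. \<Sum>l<p. t k * s l * ((\<Sum>i<m. A $$ (i, k) * U $$ (i, l)) * (\<Sum>j<n. C $$ (j, k) * V $$ (j, l))))"
proof -
  let ?f = "\<lambda>i j k l. t k * s l * (A $$ (i, k) * U $$ (i, l) * (C $$ (j, k) * V $$ (j, l)))"
  have "(\<Sum>i<m. \<Sum>j<n. (A * mat_diag p t * C\<^sup>T) $$ (i, j) * (U * mat_diag p s * V\<^sup>T) $$ (i, j)) =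
    (\<Sum>i<m. \<Sum>j<n. \<Sum>k<p. \<Sum>l<p. ?f i j k l)"
    by (intro sum.cong refl, simp only: lessThan_iff diag_conj_entry[OF assms(1,2)]
        diag_conj_entry[OF assms(3,4)] sum_product) (simp add: mult_ac)
  also have "\<dots> = (\<Sum>i<m. \<Sum>k<p. \<Sum>j<n. \<Sum>l<p. ?f i j k l)"
    by (rule sum.cong[OF refl], rule sum.swap)
  also have "\<dots> = (\<Sum>k<p. \<Sum>i<m. \<Sum>l<p. \<Sum>j<n. ?f i j k l)"
    by (subst sum.swap, rule sum.cong[OF refl], rule sum.cong[OF refl], rule sum.swap)
  also have "\<dots> = (\<Sum>k<p. \<Sum>l<p. \<Sum>i<m. \<Sum>j<n. ?f i j k l)"
    by (rule sum.cong[OF refl], rule sum.swap)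
  finally show ?thesis unfolding sum_product unfolding sum_distrib_left .
qed

lemma frobenius_norm_diag_conj:
  fixes U V :: "real mat"
  assumes U: "U \<in> carrier_mat m p" "U\<^sup>T * U = 1\<^sub>m p" and V: "V \<in> carrier_mat n p" "V\<^sup>T * V = 1\<^sub>m p"
  shows "(frobenius_norm (U * mat_diag p d * V\<^sup>T))\<^sup>2 = (\<Sum>i<p. (d i)\<^sup>2)"
proof -
  have carrier: "U * mat_diag p d * V\<^sup>T \<in> carrier_mat m n"
    using U V by (auto intro!: mult_carrier_mat)
  have "(frobenius_norm (U * mat_diag p d * V\<^sup>T))\<^sup>2 = (\<Sum>k<p. \<Sum>l<p. d k * d l *
      ((\<Sum>i<m. U $$ (i, k) * U $$ (i, l)) * (\<Sum>j<n. V $$ (j, k) * V $$ (j, l))))"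
    unfolding frobenius_inner_diag_conj[OF U(1) V(1) U(1) V(1), of d d, symmetric] frobenius_norm_sq[OF carrier]
    by (simp only: power2_eq_square)
  also have "\<dots> = (\<Sum>k<p. \<Sum>l<p. d k * d l * ((if k = l then 1 else 0) * (if k = l then 1 else 0)))"
    by (intro sum.cong refl) (use U V in \<open>simp add: orthonormal_cols_iff\<close>)
  also have "\<dots> = (\<Sum>k<p. (d k)\<^sup>2)"
    by (rule sum.cong) (auto simp: power2_eq_square if_distrib[of "(*) _"] cong: if_cong)
  finally show ?thesis .
qed

text \<open>Expanding the square leaves von Neumann's trace inequality: the inner product of the two
  matrices is at most the sum of the products \<open>t k * s k\<close>. The overlaps
  \<open>\<alpha>\<close>, \<open>\<beta>\<close> of the singular vectors reduce it to the
  rearrangement bound.\<close>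

lemma mirsky_inequality:
  fixes A C U V :: "real mat" and t s :: "nat \<Rightarrow> real"
  assumes A: "A \<in> carrier_mat m p" "A\<^sup>T * A = 1\<^sub>m p" and C: "C \<in> carrier_mat n p" "C\<^sup>T * C = 1\<^sub>m p"
    and U: "U \<in> carrier_mat m p" "U\<^sup>T * U = 1\<^sub>m p" and V: "V \<in> carrier_mat n p" "V\<^sup>T * V = 1\<^sub>m p"
    and t: "\<And>i. i < p \<Longrightarrow> 0 \<le> t i" "\<And>i j. i \<le> j \<Longrightarrow> j < p \<Longrightarrow> t j \<le> t i"
    and s: "\<And>i. i < p \<Longrightarrow> 0 \<le> s i" "\<And>i j. i \<le> j \<Longrightarrow> j < p \<Longrightarrow> s j \<le> s i"
  shows "(\<Sum>i<p. (t i - s i)\<^sup>2) \<le>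
    (frobenius_norm (A * mat_diag p t * C\<^sup>T - U * mat_diag p s * V\<^sup>T))\<^sup>2"
proof -
  let ?X = "A * mat_diag p t * C\<^sup>T" and ?Z = "U * mat_diag p s * V\<^sup>T"
  have X: "?X \<in> carrier_mat m n" and Z: "?Z \<in> carrier_mat m n"
    using A C U V by (auto intro!: mult_carrier_mat)
  define \<alpha> where "\<alpha> k l = (\<Sum>i<m. A $$ (i, k) * U $$ (i, l))" for k l
  define \<beta> where "\<beta> k l = (\<Sum>j<n. C $$ (j, k) * V $$ (j, l))" for k l
  define w where "w k l = ((\<alpha> k l)\<^sup>2 + (\<beta> k l)\<^sup>2) / 2" for k l
  have unit: "(\<Sum>l<q. (M $$ (l, i))\<^sup>2) = 1" if "M \<in> carrier_mat q p" "M\<^sup>T * M = 1\<^sub>m p" "i < p"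
    for M :: "real mat" and q i
    using that by (simp add: orthonormal_cols_iff power2_eq_square)
  have "(\<Sum>i<m. \<Sum>j<n. ?X $$ (i, j) * ?Z $$ (i, j)) = (\<Sum>k<p. \<Sum>l<p. t k * s l * (\<alpha> k l * \<beta> k l))"
    unfolding \<alpha>_def \<beta>_def by (rule frobenius_inner_diag_conj[OF A(1) C(1) U(1) V(1)])
  \<comment> \<open>The signed products of overlaps are replaced by means of squares. Those are
    non-negative, and Bessel's inequality bounds their row and column sums by 1.\<close>
  also have "\<dots> \<le> (\<Sum>k<p. \<Sum>l<p. t k * s l * w k l)"
  proof (intro sum_mono mult_left_mono)
    fix k l
    show "\<alpha> k l * \<beta> k l \<le> w k l"
      using sum_squares_bound[of "\<alpha> k l" "\<beta> k l"] by (simp add: w_def)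
  qed (use t s in auto)
  also have "\<dots> \<le> (\<Sum>k<p. t k * s k)"
  proof (rule doubly_substochastic_rearrangement[OF t s])
    fix i assume i: "i < p"
    have "(\<Sum>j<p. (\<alpha> i j)\<^sup>2) \<le> 1"
      using bessel_inequality_cols[OF U, of "\<lambda>l. A $$ (l, i)"] unit[OF A i] by (simp add: \<alpha>_def)
    moreover have "(\<Sum>j<p. (\<beta> i j)\<^sup>2) \<le> 1"
      using bessel_inequality_cols[OF V, of "\<lambda>l. C $$ (l, i)"] unit[OF C i] by (simp add: \<beta>_def)
    ultimately show "(\<Sum>j<p. w i j) \<le> 1"
      by (simp add: w_def sum_divide_distrib[symmetric] sum.distrib)
    have "(\<Sum>j<p. (\<alpha> j i)\<^sup>2) \<le> 1"
      using bessel_inequality_cols[OF A, of "\<lambda>l. U $$ (l, i)"] unit[OF U i] by (simp add: \<alpha>_def mult.commute)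
    moreover have "(\<Sum>j<p. (\<beta> j i)\<^sup>2) \<le> 1"
      using bessel_inequality_cols[OF C, of "\<lambda>l. V $$ (l, i)"] unit[OF V i] by (simp add: \<beta>_def mult.commute)
    ultimately show "(\<Sum>j<p. w j i) \<le> 1"
      by (simp add: w_def sum_divide_distrib[symmetric] sum.distrib)
  qed (auto simp: w_def)
  finally have trace: "(\<Sum>i<m. \<Sum>j<n. ?X $$ (i, j) * ?Z $$ (i, j)) \<le> (\<Sum>k<p. t k * s k)" .
  note frobenius_norm_diff_sq[OF X Z]
  also have "(frobenius_norm ?X)\<^sup>2 = (\<Sum>i<p. (t i)\<^sup>2)" by (rule frobenius_norm_diag_conj[OF A C])
  also have "(frobenius_norm ?Z)\<^sup>2 = (\<Sum>i<p. (s i)\<^sup>2)" by (rule frobenius_norm_diag_conj[OF U V])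
  finally show ?thesis
    using trace by (simp add: power2_diff sum.distrib sum_subtractf sum_distrib_left[symmetric] mult.assoc)
qed

section \<open>Uniqueness of the singular values\<close>

lemma is_svdD:
  assumes "is_svd A U \<sigma> V" "A \<in> carrier_mat m n"
  shows "U \<in> carrier_mat m (min m n)" "U\<^sup>T * U = 1\<^sub>m (min m n)"
    "V \<in> carrier_mat n (min m n)" "V\<^sup>T * V = 1\<^sub>m (min m n)"
    "length \<sigma> = min m n" "\<And>i. i < min m n \<Longrightarrow> 0 \<le> \<sigma> ! i"
    "\<And>i j. i \<le> j \<Longrightarrow> j < min m n \<Longrightarrow> \<sigma> ! j \<le> \<sigma> ! i"
    "A = U * mat_diag (min m n) (\<lambda>i. \<sigma> ! i) * V\<^sup>T"
proof -
  have *: "U \<in> carrier_mat m (min m n) \<and> U\<^sup>T * U = 1\<^sub>m (min m n) \<and>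
    V \<in> carrier_mat n (min m n) \<and> V\<^sup>T * V = 1\<^sub>m (min m n) \<and> length \<sigma> = min m n \<and>
    (\<forall>s \<in> set \<sigma>. 0 \<le> s) \<and> sorted_wrt (\<ge>) \<sigma> \<and> A = U * diag_of_list \<sigma> * V\<^sup>T"
    using assms unfolding is_svd_def Let_def by (metis carrier_matD)
  then show "U \<in> carrier_mat m (min m n)" "U\<^sup>T * U = 1\<^sub>m (min m n)"
    "V \<in> carrier_mat n (min m n)" "V\<^sup>T * V = 1\<^sub>m (min m n)" "length \<sigma> = min m n"
    "\<And>i. i < min m n \<Longrightarrow> 0 \<le> \<sigma> ! i" by auto
  show "A = U * mat_diag (min m n) (\<lambda>i. \<sigma> ! i) * V\<^sup>T"
    using * by (simp add: diag_of_list_def)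
  show "\<sigma> ! j \<le> \<sigma> ! i" if "i \<le> j" "j < min m n" for i j
    using * that sorted_wrt_nth_less[of "(\<ge>)" \<sigma> i j] by (cases "i = j") auto
qed

lemma mirsky_inequality_svd:
  assumes X: "is_svd X A \<tau> C" "X \<in> carrier_mat m n" and Z: "is_svd Z U \<sigma> V" "Z \<in> carrier_mat m n"
  shows "(\<Sum>i<min m n. (\<tau> ! i - \<sigma> ! i)\<^sup>2) \<le> (frobenius_norm (X - Z))\<^sup>2"
  using mirsky_inequality[OF is_svdD(1-4)[OF X] is_svdD(1-4)[OF Z], of "(!) \<tau>" "(!) \<sigma>"]
    is_svdD(6-8)[OF X] is_svdD(6-8)[OF Z] by simp

text \<open>Mirsky's inequality for two decompositions of the same matrix has right-hand side 0.
  Hence the two lists agree and the definite description is meaningful.\<close>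

lemma singular_values_eqI:
  assumes svd: "is_svd A U \<sigma> V"
  shows "singular_values A = \<sigma>"
proof -
  define m where "m = dim_row A"
  define n where "n = dim_col A"
  have A: "A \<in> carrier_mat m n" by (auto simp: m_def n_def)
  have "\<tau> = \<sigma>" if "is_svd A U' \<tau> V'" for U' \<tau> V'
  proof (rule nth_equalityI)
    have "(frobenius_norm (A - A))\<^sup>2 = 0"
      by (subst frobenius_norm_sq[OF minus_carrier_mat[OF A]]) (use A in simp)
    then have "(\<Sum>i<min m n. (\<tau> ! i - \<sigma> ! i)\<^sup>2) \<le> 0"
      using mirsky_inequality_svd[OF that A svd A] by simp
    moreover have "0 \<le> (\<Sum>i<min m n. (\<tau> ! i - \<sigma> ! i)\<^sup>2)" by (rule sum_nonneg) simp
    ultimately have "(\<Sum>i<min m n. (\<tau> ! i - \<sigma> ! i)\<^sup>2) = 0" by linarith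
    then show "\<tau> ! i = \<sigma> ! i" if "i < length \<tau>" for i
      using that is_svdD(5)[OF \<open>is_svd A U' \<tau> V'\<close> A] by (simp add: sum_nonneg_eq_0_iff)
  qed (use is_svdD(5)[OF that A] is_svdD(5)[OF svd A] in simp)
  then show ?thesis unfolding singular_values_def using svd by blast
qed

section \<open>Odd matrix polynomials\<close>

lemma diag_conj_carrier:
  "\<lbrakk>A \<in> carrier_mat m p; C \<in> carrier_mat n p\<rbrakk> \<Longrightarrow> A * mat_diag p d * C\<^sup>T \<in> carrier_mat m n"
  by (intro mult_carrier_mat[of _ m p _ n] mult_carrier_mat[of _ m p _ p]) auto

lemma diag_conj_add:
  fixes A C :: "real mat"
  assumes "A \<in> carrier_mat m p" "C \<in> carrier_mat n p"
  shows "A * mat_diag p d * C\<^sup>T + A * mat_diag p e * C\<^sup>T = A * mat_diag p (\<lambda>i. d i + e i) * C\<^sup>T"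
proof (rule eq_matI)
  fix i j
  assume "i < dim_row (A * mat_diag p (\<lambda>i. d i + e i) * C\<^sup>T)"
    "j < dim_col (A * mat_diag p (\<lambda>i. d i + e i) * C\<^sup>T)"
  then have ij: "i < m" "j < n" using assms by auto
  then have "(A * mat_diag p d * C\<^sup>T + A * mat_diag p e * C\<^sup>T) $$ (i, j)
      = (A * mat_diag p d * C\<^sup>T) $$ (i, j) + (A * mat_diag p e * C\<^sup>T) $$ (i, j)"
    by (intro index_add_mat(1)) (use assms in simp_all)
  also have "\<dots> = (A * mat_diag p (\<lambda>i. d i + e i) * C\<^sup>T) $$ (i, j)"
    unfolding diag_conj_entry[OF assms ij] by (simp only: sum.distrib[symmetric] distrib_left distrib_right)
  finally show "(A * mat_diag p d * C\<^sup>T + A * mat_diag p e * C\<^sup>T) $$ (i, j) =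
    (A * mat_diag p (\<lambda>i. d i + e i) * C\<^sup>T) $$ (i, j)" .
qed (use assms in auto)

lemma diag_conj_smult:
  fixes A C :: "real mat"
  assumes "A \<in> carrier_mat m p" "C \<in> carrier_mat n p"
  shows "c \<cdot>\<^sub>m (A * mat_diag p d * C\<^sup>T) = A * mat_diag p (\<lambda>i. c * d i) * C\<^sup>T"
proof (rule eq_matI)
  fix i j
  assume "i < dim_row (A * mat_diag p (\<lambda>i. c * d i) * C\<^sup>T)"
    "j < dim_col (A * mat_diag p (\<lambda>i. c * d i) * C\<^sup>T)"
  then have ij: "i < m" "j < n" using assms by auto
  then have "(c \<cdot>\<^sub>m (A * mat_diag p d * C\<^sup>T)) $$ (i, j) = c * (A * mat_diag p d * C\<^sup>T) $$ (i, j)"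
    by (intro index_smult_mat(1)) (use assms in simp_all)
  also have "\<dots> = (A * mat_diag p (\<lambda>i. c * d i) * C\<^sup>T) $$ (i, j)"
    unfolding diag_conj_entry[OF assms ij] by (simp add: sum_distrib_left algebra_simps)
  finally show "(c \<cdot>\<^sub>m (A * mat_diag p d * C\<^sup>T)) $$ (i, j) =
    (A * mat_diag p (\<lambda>i. c * d i) * C\<^sup>T) $$ (i, j)" .
qed (use assms in auto)

lemma diag_conj_transpose:
  fixes A C :: "real mat"
  assumes "A \<in> carrier_mat m p" "C \<in> carrier_mat n p"
  shows "(A * mat_diag p d * C\<^sup>T)\<^sup>T = C * mat_diag p d * A\<^sup>T"
proof (rule eq_matI)
  fix i j
  assume "i < dim_row (C * mat_diag p d * A\<^sup>T)" "j < dim_col (C * mat_diag p d * A\<^sup>T)"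
  then have ij: "i < n" "j < m" using assms by auto
  then have "(A * mat_diag p d * C\<^sup>T)\<^sup>T $$ (i, j) = (A * mat_diag p d * C\<^sup>T) $$ (j, i)"
    by (intro index_transpose_mat(1)) (use assms in simp_all)
  also have "\<dots> = (C * mat_diag p d * A\<^sup>T) $$ (i, j)"
    unfolding diag_conj_entry[OF assms ij(2,1)] diag_conj_entry[OF assms(2,1) ij]
    by (simp add: mult_ac)
  finally show "(A * mat_diag p d * C\<^sup>T)\<^sup>T $$ (i, j) = (C * mat_diag p d * A\<^sup>T) $$ (i, j)" .
qed (use assms in auto)

lemma diag_conj_zero:
  fixes A C :: "real mat"
  assumes "A \<in> carrier_mat m p" "C \<in> carrier_mat n p" "\<And>i. i < p \<Longrightarrow> d i = 0"
  shows "A * mat_diag p d * C\<^sup>T = 0\<^sub>m m n"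
proof (rule eq_matI)
  fix i j assume "i < dim_row (0\<^sub>m m n :: real mat)" "j < dim_col (0\<^sub>m m n :: real mat)"
  then have ij: "i < m" "j < n" by auto
  show "(A * mat_diag p d * C\<^sup>T) $$ (i, j) = 0\<^sub>m m n $$ (i, j)"
    unfolding diag_conj_entry[OF assms(1,2) ij] using ij assms(3) by simp
qed (use assms in auto)

lemma mat_diag_cong: "(\<And>i. i < p \<Longrightarrow> d i = e i) \<Longrightarrow> mat_diag p d = mat_diag p e"
  by (auto simp: mat_diag_def)

lemma diag_conj_mult:
  fixes A B C :: "real mat"
  assumes A: "A \<in> carrier_mat m p" and B: "B \<in> carrier_mat n p" "B\<^sup>T * B = 1\<^sub>m p"
    and C: "C \<in> carrier_mat q p"
  shows "(A * mat_diag p d * B\<^sup>T) * (B * mat_diag p e * C\<^sup>T) = A * mat_diag p (\<lambda>i. d i * e i) * C\<^sup>T"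
proof -
  have eC: "mat_diag p e * C\<^sup>T \<in> carrier_mat p q" using C by (auto intro!: mult_carrier_mat)
  have Ad: "A * mat_diag p d \<in> carrier_mat m p" using A by (auto intro!: mult_carrier_mat)
  have "B * mat_diag p e * C\<^sup>T = B * (mat_diag p e * C\<^sup>T)"
    by (rule assoc_mult_mat[of _ n p _ p _ q]) (use B C in auto)
  then have "(A * mat_diag p d * B\<^sup>T) * (B * mat_diag p e * C\<^sup>T)
      = A * mat_diag p d * (B\<^sup>T * (B * (mat_diag p e * C\<^sup>T)))"
    using assoc_mult_mat[of "A * mat_diag p d" m p "B\<^sup>T" n "B * (mat_diag p e * C\<^sup>T)" q] Ad B eC by simp
  also have "B\<^sup>T * (B * (mat_diag p e * C\<^sup>T)) = (B\<^sup>T * B) * (mat_diag p e * C\<^sup>T)"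
    by (rule assoc_mult_mat[symmetric, of _ p n _ p _ q]) (use B eC in auto)
  also have "\<dots> = mat_diag p e * C\<^sup>T" unfolding B(2) using eC by (rule left_mult_one_mat)
  also have "A * mat_diag p d * (mat_diag p e * C\<^sup>T) = (A * mat_diag p d * mat_diag p e) * C\<^sup>T"
    by (rule assoc_mult_mat[symmetric, of _ m p _ p _ q]) (use Ad C in auto)
  also have "A * mat_diag p d * mat_diag p e = A * (mat_diag p d * mat_diag p e)"
    by (rule assoc_mult_mat[of _ m p _ p _ p]) (use A in auto)
  finally show ?thesis by simp
qed

text \<open>Horner's scheme for the sum of \<open>c\<^sub>j M (M\<^sup>T M)\<^sup>j\<close>. The
  form makes sense for rectangular \<open>M\<close> and mentions no singular value
  decomposition.\<close>

primrec odd_matpoly :: "real list \<Rightarrow> real mat \<Rightarrow> real mat" where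
  "odd_matpoly [] M = 0\<^sub>m (dim_row M) (dim_col M)"
| "odd_matpoly (c # cs) M = c \<cdot>\<^sub>m M + odd_matpoly cs M * (M\<^sup>T * M)"

lemma odd_matpoly_carrier [simp, intro]: "M \<in> carrier_mat m n \<Longrightarrow> odd_matpoly cs M \<in> carrier_mat m n"
proof (induction cs)
  case (Cons c cs)
  then have "odd_matpoly cs M * (M\<^sup>T * M) \<in> carrier_mat m n"
    by (intro mult_carrier_mat[of _ m n _ n]) auto
  then show ?case using Cons.prems by simp
qed auto

text \<open>The Gram matrix is \<open>V * mat_diag p (\<lambda>i. d i * d i) * V\<^sup>T\<close>, so
  each Horner step acts on the diagonal alone.\<close>

lemma odd_matpoly_diag_conj:
  fixes U V :: "real mat"
  assumes U: "U \<in> carrier_mat m p" "U\<^sup>T * U = 1\<^sub>m p" and V: "V \<in> carrier_mat n p" "V\<^sup>T * V = 1\<^sub>m p"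
  shows "odd_matpoly cs (U * mat_diag p d * V\<^sup>T) =
    U * mat_diag p (\<lambda>i. d i * poly (Poly cs) ((d i)\<^sup>2)) * V\<^sup>T"
proof (induction cs)
  case Nil
  then show ?case using U V by (simp add: diag_conj_zero)
next
  case (Cons c cs)
  have "odd_matpoly (c # cs) (U * mat_diag p d * V\<^sup>T) =
      c \<cdot>\<^sub>m (U * mat_diag p d * V\<^sup>T) + (U * mat_diag p (\<lambda>i. d i * poly (Poly cs) ((d i)\<^sup>2)) * V\<^sup>T)
        * (V * mat_diag p (\<lambda>i. d i * d i) * V\<^sup>T)"
    by (simp only: odd_matpoly.simps Cons diag_conj_transpose[OF U(1) V(1)] diag_conj_mult[OF V(1) U V(1)])
  also have "\<dots> = U * mat_diag p (\<lambda>i. c * d i + d i * poly (Poly cs) ((d i)\<^sup>2) * (d i * d i)) * V\<^sup>T"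
    by (simp only: diag_conj_mult[OF U(1) V V(1)] diag_conj_smult[OF U(1) V(1)] diag_conj_add[OF U(1) V(1)])
  also have "(\<lambda>i. c * d i + d i * poly (Poly cs) ((d i)\<^sup>2) * (d i * d i))
      = (\<lambda>i. d i * poly (Poly (c # cs)) ((d i)\<^sup>2))"
    by (auto simp: algebra_simps power2_eq_square)
  finally show ?case .
qed

text \<open>Orthogonality is needed on both sides: \<open>M\<^sup>T * N = 0\<close> removes the
  cross terms from the Gram matrix of the sum, and \<open>M * N\<^sup>T = 0\<close> makes the
  polynomial in one summand annihilate the Gram matrix of the other.\<close>

lemma odd_matpoly_add:
  assumes M: "M \<in> carrier_mat m n" and N: "N \<in> carrier_mat m n"
    and MN: "M\<^sup>T * N = 0\<^sub>m n n" "M * N\<^sup>T = 0\<^sub>m m m"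
  shows "odd_matpoly cs (M + N) = odd_matpoly cs M + odd_matpoly cs N"
proof -
  have NM: "N\<^sup>T * M = 0\<^sub>m n n" "N * M\<^sup>T = 0\<^sub>m m m"
    using arg_cong[OF MN(1), of transpose_mat] arg_cong[OF MN(2), of transpose_mat] M N
      transpose_mult[of "M\<^sup>T" n m N n] transpose_mult[of M m n "N\<^sup>T" m] by simp_all
  have gram: "(M + N)\<^sup>T * (M + N) = M\<^sup>T * M + N\<^sup>T * N"
  proof -
    have "(M + N)\<^sup>T * (M + N) = (M\<^sup>T * M + N\<^sup>T * M) + (M\<^sup>T * N + N\<^sup>T * N)"
      using M N by (simp add: transpose_add[of _ m n] add_mult_distrib_mat[of _ n m _ _ n]
          mult_add_distrib_mat[of _ n m _ n])
    then show ?thesis using MN NM M N by simp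
  qed
  have ann: "odd_matpoly cs X * (Y\<^sup>T * Y) = 0\<^sub>m m n"
    if X: "X \<in> carrier_mat m n" and Y: "Y \<in> carrier_mat m n" and XY: "X * Y\<^sup>T = 0\<^sub>m m m" for X Y cs
  proof -
    have "odd_matpoly cs X * Y\<^sup>T = 0\<^sub>m m m"
    proof (induction cs)
      case Nil
      then show ?case using X Y by simp
    next
      case (Cons c cs)
      have "odd_matpoly cs X * (X\<^sup>T * X) * Y\<^sup>T = odd_matpoly cs X * ((X\<^sup>T * X) * Y\<^sup>T)"
        by (rule assoc_mult_mat[of _ m n _ n _ m]) (use X Y in auto)
      also have "(X\<^sup>T * X) * Y\<^sup>T = X\<^sup>T * (X * Y\<^sup>T)"
        by (rule assoc_mult_mat[of _ n m _ n _ m]) (use X Y in auto)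
      also have "\<dots> = 0\<^sub>m n m" unfolding XY using X by simp
      also have "odd_matpoly cs X * 0\<^sub>m n m = 0\<^sub>m m m"
        by (rule right_mult_zero_mat) (use X in auto)
      finally have "odd_matpoly cs X * (X\<^sup>T * X) * Y\<^sup>T = 0\<^sub>m m m" .
      moreover have "(c \<cdot>\<^sub>m X) * Y\<^sup>T = 0\<^sub>m m m" using X Y XY by (simp add: mult_smult_assoc_mat[of _ m n _ m])
      moreover have "odd_matpoly (c # cs) X * Y\<^sup>T = (c \<cdot>\<^sub>m X) * Y\<^sup>T + odd_matpoly cs X * (X\<^sup>T * X) * Y\<^sup>T"
        unfolding odd_matpoly.simps
        by (rule add_mult_distrib_mat[of _ m n _ _ m]) (use X Y in \<open>auto intro!: mult_carrier_mat\<close>)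
      ultimately show ?case by simp
    qed
    moreover have "odd_matpoly cs X * (Y\<^sup>T * Y) = odd_matpoly cs X * Y\<^sup>T * Y"
      by (rule assoc_mult_mat[symmetric, of _ m n _ m _ n]) (use X Y in auto)
    ultimately show ?thesis using Y by simp
  qed
  show ?thesis
  proof (induction cs)
    case Nil
    then show ?case using M N by simp
  next
    case (Cons c cs)
    define P where "P = odd_matpoly cs M"
    define R where "R = odd_matpoly cs N"
    define G where "G = M\<^sup>T * M"
    define K where "K = N\<^sup>T * N"
    have carr: "P \<in> carrier_mat m n" "R \<in> carrier_mat m n" "G \<in> carrier_mat n n" "K \<in> carrier_mat n n"
      using M N by (auto simp: P_def R_def G_def K_def)
    have zero: "P * K = 0\<^sub>m m n" "R * G = 0\<^sub>m m n"
      using ann[OF M N MN(2)] ann[OF N M NM(2)] by (auto simp: P_def R_def G_def K_def)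
    have "(P + R) * (G + K) = (P * G + R * G) + (P * K + R * K)"
      using carr by (simp add: add_mult_distrib_mat[of _ m n _ _ n] mult_add_distrib_mat[of _ m n _ n])
    also have "\<dots> = P * G + R * K" using carr zero by simp
    finally have prod: "(P + R) * (G + K) = P * G + R * K" .
    have PG: "P * G \<in> carrier_mat m n" "R * K \<in> carrier_mat m n" using carr by auto
    have "odd_matpoly (c # cs) (M + N) = c \<cdot>\<^sub>m (M + N) + (P * G + R * K)"
      by (simp only: odd_matpoly.simps Cons gram prod flip: P_def R_def G_def K_def)
    also have "\<dots> = (c \<cdot>\<^sub>m M + P * G) + (c \<cdot>\<^sub>m N + R * K)"
    proof -
      have "c \<cdot>\<^sub>m (M + N) + (A + B) = (c \<cdot>\<^sub>m M + A) + (c \<cdot>\<^sub>m N + B)"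
        if "A \<in> carrier_mat m n" "B \<in> carrier_mat m n" for A B
        using M N that by (intro eq_matI) (auto simp: algebra_simps)
      then show ?thesis using PG .
    qed
    finally show ?case by (simp add: P_def R_def G_def K_def)
  qed
qed

text \<open>By \<open>QQM\<close>, passing from \<open>M\<close> to \<open>Q\<^sup>T * M\<close>
  leaves the Gram matrix unchanged. Each Horner step multiplies by it from the right, so
  \<open>Q\<close> passes through from the left.\<close>

lemma odd_matpoly_projection:
  assumes M: "M \<in> carrier_mat m n" and Q: "Q \<in> carrier_mat m k" and QQM: "Q * (Q\<^sup>T * M) = M"
  shows "Q * odd_matpoly cs (Q\<^sup>T * M) = odd_matpoly cs M"
proof (induction cs)
  case Nil
  then show ?case using M Q by simp
next
  case (Cons c cs)
  have B: "Q\<^sup>T * M \<in> carrier_mat k n" using Q M by auto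
  have gram: "(Q\<^sup>T * M)\<^sup>T * (Q\<^sup>T * M) = M\<^sup>T * M"
  proof -
    have "(Q\<^sup>T * M)\<^sup>T = M\<^sup>T * Q" using Q M by (simp add: transpose_mult[of _ k m _ n])
    moreover have "(M\<^sup>T * Q) * (Q\<^sup>T * M) = M\<^sup>T * (Q * (Q\<^sup>T * M))"
      by (rule assoc_mult_mat[of _ n m _ k _ n]) (use Q M B in auto)
    ultimately show ?thesis unfolding QQM by simp
  qed
  have "Q * odd_matpoly (c # cs) (Q\<^sup>T * M) =
      Q * (c \<cdot>\<^sub>m (Q\<^sup>T * M)) + Q * (odd_matpoly cs (Q\<^sup>T * M) * (M\<^sup>T * M))"
    unfolding odd_matpoly.simps gram
    by (rule mult_add_distrib_mat[of _ m k _ n]) (use Q M B in \<open>auto intro!: mult_carrier_mat\<close>)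
  also have "Q * (c \<cdot>\<^sub>m (Q\<^sup>T * M)) = c \<cdot>\<^sub>m M"
    using mult_smult_distrib[OF Q B] QQM by simp
  also have "Q * (odd_matpoly cs (Q\<^sup>T * M) * (M\<^sup>T * M)) = Q * odd_matpoly cs (Q\<^sup>T * M) * (M\<^sup>T * M)"
    by (rule assoc_mult_mat[symmetric, of _ m k _ n _ n]) (use Q M B in auto)
  finally show ?case by (simp add: Cons)
qed

section \<open>Interpolation by odd polynomials\<close>

lemma poly_interpolation_exists:
  fixes f :: "real \<Rightarrow> real"
  assumes "finite S"
  shows "\<exists>g. \<forall>x\<in>S. poly g x = f x"
  using assms
proof (induction S)
  case (insert x S)
  then obtain g where g: "\<forall>y\<in>S. poly g y = f y" by blast
  \<comment> \<open>Newton's correction term: \<open>h\<close> vanishes at all old nodes but not at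
    the new one, so a multiple of it adjusts the value at \<open>x\<close> only.\<close>
  define h where "h = (\<Prod>y\<in>S. [:- y, 1:])"
  have "poly h x \<noteq> 0" using insert by (auto simp: h_def poly_prod)
  moreover have "poly h y = 0" if "y \<in> S" for y using insert that by (auto simp: h_def poly_prod)
  ultimately have "\<forall>y\<in>insert x S. poly (g + smult ((f x - poly g x) / poly h x) h) y = f y"
    using g by auto
  then show ?case by blast
qed simp

text \<open>An odd polynomial is \<open>x\<close> times a polynomial in the square of
  \<open>x\<close>. On the non-negative nodes squaring is injective, so it suffices to interpolate
  the quotient of \<open>f\<close> by the identity at the squares.\<close>

lemma odd_interpolation_exists:
  fixes f :: "real \<Rightarrow> real"
  assumes "finite S" "\<And>x. x \<in> S \<Longrightarrow> 0 \<le> x" "f 0 = 0"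
  obtains cs where "\<And>x. x \<in> S \<Longrightarrow> x * poly (Poly cs) (x\<^sup>2) = f x"
proof -
  \<comment> \<open>At \<open>y = 0\<close> the quotient is 0 by convention; the factor
    \<open>x\<close> and \<open>f 0 = 0\<close> make the choice of this value irrelevant.\<close>
  obtain g where g: "\<forall>y\<in>power2 ` S. poly g y = f (sqrt y) / sqrt y"
    using poly_interpolation_exists[of "power2 ` S" "\<lambda>y. f (sqrt y) / sqrt y"] assms(1) by auto
  have "x * poly (Poly (coeffs g)) (x\<^sup>2) = f x" if "x \<in> S" for x
    using g that assms by (cases "x = 0") auto
  then show ?thesis using that by blast
qed

section \<open>The proximal operator\<close>

lemma scalar_prox_nonneg: "is_scalar_prox \<mu> rhat ystar \<Longrightarrow> 0 \<le> \<sigma> \<Longrightarrow> 0 \<le> ystar \<sigma>"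
  by (simp add: is_scalar_prox_def is_arg_min_def)

lemma scalar_prox_le:
  assumes "is_scalar_prox \<mu> rhat ystar" "0 \<le> \<sigma>" "0 \<le> y"
  shows "1/2 * (ystar \<sigma> - \<sigma>)\<^sup>2 + \<mu> * rhat (ystar \<sigma>) \<le> 1/2 * (y - \<sigma>)\<^sup>2 + \<mu> * rhat y"
  using assms unfolding is_scalar_prox_def is_arg_min_def by (meson not_le)

text \<open>Comparing each minimizer with the other one and adding the two inequalities cancels the
  terms in \<open>rhat\<close>; what remains is \<open>0 \<le> (ystar \<tau> - ystar \<sigma>) *
  (\<tau> - \<sigma>)\<close>.\<close>

lemma scalar_prox_mono:
  assumes prox: "is_scalar_prox \<mu> rhat ystar" and "0 \<le> \<sigma>" "\<sigma> \<le> \<tau>"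
  shows "ystar \<sigma> \<le> ystar \<tau>"
proof (cases "\<sigma> = \<tau>")
  case False
  have "0 \<le> (ystar \<tau> - ystar \<sigma>) * (\<tau> - \<sigma>)"
    using scalar_prox_le[OF prox, of \<sigma> "ystar \<tau>"] scalar_prox_le[OF prox, of \<tau> "ystar \<sigma>"] assms
      scalar_prox_nonneg[OF prox, of \<sigma>] scalar_prox_nonneg[OF prox, of \<tau>]
    by (simp add: power2_eq_square algebra_simps)
  then show ?thesis using False assms by (simp add: zero_le_mult_iff)
qed simp

text \<open>Two things are to be shown for the definite description: the candidate \<open>X\<close>
  minimizes the objective, which Mirsky's inequality reduces to the scalar problems, and
  \<open>X\<close> is the same for every singular value decomposition of \<open>Z\<close>.\<close>

lemma prox_eq:
  assumes prox: "is_scalar_prox \<mu> rhat ystar" and y0: "ystar 0 = 0"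
    and svd: "is_svd Z U \<sigma> V" and Z: "Z \<in> carrier_mat m n"
  shows "prox \<mu> rhat ystar Z = U * mat_diag (min m n) (\<lambda>i. ystar (\<sigma> ! i)) * V\<^sup>T"
proof -
  define p where "p = min m n"
  note svdD = is_svdD[OF svd Z, folded p_def]
  define X where "X = U * mat_diag p (\<lambda>i. ystar (\<sigma> ! i)) * V\<^sup>T"
  have X: "X \<in> carrier_mat m n" unfolding X_def using svdD(1,3) by (rule diag_conj_carrier)
  have diag: "diag_of_list (map ystar \<sigma>) = mat_diag p (\<lambda>i. ystar (\<sigma> ! i))"
    using svdD(5) by (auto simp: diag_of_list_def intro: mat_diag_cong)
  \<comment> \<open>As \<open>ystar\<close> is monotone, the new values stay in non-increasing
    order; thus they are the singular values of \<open>X\<close> and give its regularizer.\<close>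
  have Xsvd: "is_svd X U (map ystar \<sigma>) V"
  proof -
    have "sorted_wrt (\<ge>) (map ystar \<sigma>)"
      unfolding sorted_wrt_iff_nth_less using svdD(5-7) scalar_prox_mono[OF prox] by simp
    moreover have "\<forall>s\<in>set (map ystar \<sigma>). 0 \<le> s"
      using svdD(5,6) scalar_prox_nonneg[OF prox] by (auto simp: in_set_conv_nth)
    ultimately show ?thesis
      unfolding is_svd_def Let_def diag using X svdD(1-5) by (simp add: p_def X_def)
  qed
  have reg: "spectral_reg rhat Y = (\<Sum>i<p. rhat (\<tau> ! i))"
    if "is_svd Y A \<tau> C" "Y \<in> carrier_mat m n" for Y A \<tau> C
    using is_svdD(5)[OF that] singular_values_eqI[OF that(1)]
    by (simp add: spectral_reg_def sum_list_sum_nth p_def atLeast0LessThan)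
  let ?obj = "\<lambda>Y. 1/2 * (frobenius_norm (Y - Z))\<^sup>2 + \<mu> * spectral_reg rhat Y"
  have "?obj X = (\<Sum>i<p. 1/2 * (ystar (\<sigma> ! i) - \<sigma> ! i)\<^sup>2 + \<mu> * rhat (ystar (\<sigma> ! i)))"
  proof -
    have "Z = U * mat_diag p (\<lambda>i. \<sigma> ! i) * V\<^sup>T" by (rule svdD(8))
    then have "X = U * mat_diag p (\<lambda>i. ystar (\<sigma> ! i) - \<sigma> ! i) * V\<^sup>T + Z"
      using diag_conj_add[OF svdD(1,3), of "\<lambda>i. ystar (\<sigma> ! i) - \<sigma> ! i" "\<lambda>i. \<sigma> ! i"]
      by (simp add: X_def)
    moreover have "\<dots> - Z = U * mat_diag p (\<lambda>i. ystar (\<sigma> ! i) - \<sigma> ! i) * V\<^sup>T"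
    proof -
      have "Y + Z - Z = Y" if "Y \<in> carrier_mat m n" for Y
        using that Z by (intro eq_matI) auto
      then show ?thesis using diag_conj_carrier[OF svdD(1,3)] .
    qed
    ultimately have "X - Z = U * mat_diag p (\<lambda>i. ystar (\<sigma> ! i) - \<sigma> ! i) * V\<^sup>T" by simp
    then have "(frobenius_norm (X - Z))\<^sup>2 = (\<Sum>i<p. (ystar (\<sigma> ! i) - \<sigma> ! i)\<^sup>2)"
      using frobenius_norm_diag_conj[OF svdD(1-4)] by simp
    moreover have "spectral_reg rhat X = (\<Sum>i<p. rhat (ystar (\<sigma> ! i)))"
      using reg[OF Xsvd X] svdD(5) by simp
    ultimately show ?thesis by (simp add: sum.distrib sum_distrib_left)
  qed
  \<comment> \<open>Scalar optimality replaces each \<open>ystar (\<sigma> ! i)\<close> by the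
    singular value \<open>\<tau> ! i\<close> of \<open>Y\<close>, and Mirsky's inequality then
    passes to the Frobenius distance.\<close>
  also have "\<dots> \<le> ?obj Y" if Y: "Y \<in> carrier_mat m n" for Y
  proof -
    obtain A \<tau> C where Ysvd: "is_svd Y A \<tau> C" using svd_exists by blast
    note YD = is_svdD[OF Ysvd Y, folded p_def]
    have "(\<Sum>i<p. 1/2 * (ystar (\<sigma> ! i) - \<sigma> ! i)\<^sup>2 + \<mu> * rhat (ystar (\<sigma> ! i)))
        \<le> (\<Sum>i<p. 1/2 * (\<tau> ! i - \<sigma> ! i)\<^sup>2 + \<mu> * rhat (\<tau> ! i))"
      by (intro sum_mono scalar_prox_le[OF prox]) (use svdD(6) YD(6) in auto)
    also have "\<dots> = 1/2 * (\<Sum>i<p. (\<tau> ! i - \<sigma> ! i)\<^sup>2) + \<mu> * spectral_reg rhat Y"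
      unfolding reg[OF Ysvd Y] by (simp add: sum.distrib sum_distrib_left)
    also have "\<dots> \<le> ?obj Y"
      using mirsky_inequality_svd[OF Ysvd Y svd Z] by (simp add: p_def)
    finally show ?thesis .
  qed
  finally have "is_arg_min ?obj (\<lambda>Y. Y \<in> carrier_mat (dim_row Z) (dim_col Z)) X"
    using X Z by (auto simp: is_arg_min_def not_less)
  \<comment> \<open>Both matrices equal \<open>odd_matpoly cs Z\<close> for a polynomial
    interpolating \<open>ystar\<close> on the singular values, and this expression does not depend
    on the singular vectors.\<close>
  moreover have "Y = X" if Y: "is_svd Z U' \<tau> V'" "Y = U' * diag_of_list (map ystar \<tau>) * V'\<^sup>T" for Y U' \<tau> V'
  proof -
    have \<tau>: "\<tau> = \<sigma>" using singular_values_eqI[OF Y(1)] singular_values_eqI[OF svd] by simp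
    note D = is_svdD[OF Y(1) Z, folded p_def, unfolded \<tau>]
    obtain cs where cs: "\<And>x. x \<in> set \<sigma> \<Longrightarrow> x * poly (Poly cs) (x\<^sup>2) = ystar x"
      using odd_interpolation_exists[of "set \<sigma>" ystar] y0 svdD(5,6)
      by (metis List.finite_set in_set_conv_nth)
    have "mat_diag p (\<lambda>i. \<sigma> ! i * poly (Poly cs) ((\<sigma> ! i)\<^sup>2)) = mat_diag p (\<lambda>i. ystar (\<sigma> ! i))"
      by (rule mat_diag_cong) (use cs svdD(5) in auto)
    then show ?thesis
      using odd_matpoly_diag_conj[OF svdD(1-4), of cs "(!) \<sigma>"] odd_matpoly_diag_conj[OF D(1-4), of cs "(!) \<sigma>"]
        svdD(8) D(8) Y(2) by (simp add: X_def diag \<tau>)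
  qed
  moreover have "X = U * diag_of_list (map ystar \<sigma>) * V\<^sup>T" by (simp add: X_def diag)
  ultimately show ?thesis
    unfolding prox_def p_def[symmetric] X_def[symmetric] using svd by (intro the_equality) blast+
qed

section \<open>Compression to a subspace\<close>

text \<open>A singular value of the compression is a bilinear form of the original matrix at two
  unit vectors, namely \<open>Q\<close> times a left singular vector and a right one. Bessel's
  inequality bounds such a form by the largest admissible diagonal entry.\<close>

lemma compression_singular_value_le:
  fixes Q U V :: "real mat"
  assumes Q: "Q \<in> carrier_mat m k" "Q\<^sup>T * Q = 1\<^sub>m k"
    and U: "U \<in> carrier_mat m p" "U\<^sup>T * U = 1\<^sub>m p" and V: "V \<in> carrier_mat n p" "V\<^sup>T * V = 1\<^sub>m p"
    and d: "\<And>i. i < p \<Longrightarrow> 0 \<le> d i" "\<And>i. i < p \<Longrightarrow> d i \<le> \<gamma>" and \<gamma>: "0 \<le> \<gamma>"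
    and svd: "is_svd (Q\<^sup>T * (U * mat_diag p d * V\<^sup>T)) A \<tau> C" and j: "j < min k n"
  shows "\<tau> ! j \<le> \<gamma>"
proof -
  define q where "q = min k n"
  let ?Z = "U * mat_diag p d * V\<^sup>T"
  have Z: "?Z \<in> carrier_mat m n" using U(1) V(1) by (rule diag_conj_carrier)
  have W: "Q\<^sup>T * ?Z \<in> carrier_mat k n" by (rule mult_carrier_mat[OF _ Z]) (use Q in simp)
  note D = is_svdD[OF svd W, folded q_def]
  \<comment> \<open>The left singular vectors of the compression, lifted to the large space; they
    stay orthonormal because \<open>Q\<close> is an isometry.\<close>
  define P where "P = Q * A"
  have P: "P \<in> carrier_mat m q" using Q D(1) by (simp add: P_def)
  have Pt: "P\<^sup>T = A\<^sup>T * Q\<^sup>T" unfolding P_def by (rule transpose_mult[OF Q(1) D(1)])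
  have PP: "P\<^sup>T * P = 1\<^sub>m q"
  proof -
    have "P\<^sup>T * P = A\<^sup>T * (Q\<^sup>T * (Q * A))"
      unfolding Pt unfolding P_def by (rule assoc_mult_mat[of _ q k _ m _ q]) (use Q D(1) in auto)
    also have "Q\<^sup>T * (Q * A) = (Q\<^sup>T * Q) * A"
      by (rule assoc_mult_mat[symmetric, of _ k m _ k _ q]) (use Q D(1) in auto)
    also have "\<dots> = A" unfolding Q(2) using D(1) by (rule left_mult_one_mat)
    finally show ?thesis using D(2) by simp
  qed
  have "A\<^sup>T * (Q\<^sup>T * ?Z) * C = mat_diag q (\<lambda>i. \<tau> ! i)"
  proof -
    let ?T = "mat_diag q (\<lambda>i. \<tau> ! i)"
    have TC: "?T * C\<^sup>T \<in> carrier_mat q n" by (rule mult_carrier_mat[of _ q q _ n]) (use D(3) in auto)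
    have "A\<^sup>T * (Q\<^sup>T * ?Z) = A\<^sup>T * (A * (?T * C\<^sup>T))"
      unfolding D(8) by (rule arg_cong[OF assoc_mult_mat[of _ k q _ q _ n]]) (use D(1,3) in auto)
    also have "\<dots> = (A\<^sup>T * A) * (?T * C\<^sup>T)"
      by (rule assoc_mult_mat[symmetric, of _ q k _ q _ n]) (use D(1) TC in auto)
    also have "\<dots> = ?T * C\<^sup>T" unfolding D(2) using TC by (rule left_mult_one_mat)
    also have "\<dots> * C = ?T * (C\<^sup>T * C)"
      by (rule assoc_mult_mat[of _ q q _ n _ q]) (use D(3) in auto)
    also have "\<dots> = ?T" unfolding D(4) by (rule right_mult_one_mat[of _ q]) simp
    finally show ?thesis .
  qed
  moreover have "A\<^sup>T * (Q\<^sup>T * ?Z) * C = (P\<^sup>T * U) * mat_diag p d * (C\<^sup>T * V)\<^sup>T"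
  proof -
    have PU: "P\<^sup>T * U \<in> carrier_mat q p" using P U by simp
    have Ud: "U * mat_diag p d \<in> carrier_mat m p" using U by (intro mult_carrier_mat[of _ m p]) auto
    have "A\<^sup>T * (Q\<^sup>T * ?Z) = P\<^sup>T * ?Z"
      unfolding Pt by (rule assoc_mult_mat[symmetric, of _ q k _ m _ n]) (use Q Z D(1) in auto)
    also have "\<dots> = P\<^sup>T * (U * mat_diag p d) * V\<^sup>T"
      by (rule assoc_mult_mat[symmetric, of _ q m _ p _ n]) (use P Ud V in auto)
    also have "P\<^sup>T * (U * mat_diag p d) = P\<^sup>T * U * mat_diag p d"
      by (rule assoc_mult_mat[symmetric, of _ q m _ p _ p]) (use P U in auto)
    also have "P\<^sup>T * U * mat_diag p d * V\<^sup>T * C = P\<^sup>T * U * mat_diag p d * (V\<^sup>T * C)"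
      by (rule assoc_mult_mat[of _ q p _ n _ q])
        (use mult_carrier_mat[OF PU mat_diag_dim] V D(3) in auto)
    also have "V\<^sup>T * C = (C\<^sup>T * V)\<^sup>T" using transpose_mult[of "C\<^sup>T" q n V p] D(3) V by simp
    finally show ?thesis .
  qed
  \<comment> \<open>The diagonal entry at \<open>j\<close> expresses \<open>\<tau> ! j\<close>
    through the coefficients \<open>\<alpha>\<close>, \<open>\<beta>\<close> of column
    \<open>j\<close> of \<open>P\<close> and of \<open>C\<close> in the columns of \<open>U\<close>
    and of \<open>V\<close>.\<close>
  ultimately have T: "mat_diag q (\<lambda>i. \<tau> ! i) = (P\<^sup>T * U) * mat_diag p d * (C\<^sup>T * V)\<^sup>T" by simp
  have j: "j < q" using j by (simp add: q_def)
  define \<alpha> where "\<alpha> i = (\<Sum>l<m. P $$ (l, j) * U $$ (l, i))" for i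
  define \<beta> where "\<beta> i = (\<Sum>l<n. C $$ (l, j) * V $$ (l, i))" for i
  have "(\<Sum>i<p. (\<alpha> i)\<^sup>2) \<le> (\<Sum>l<m. (P $$ (l, j))\<^sup>2)"
    unfolding \<alpha>_def by (rule bessel_inequality_cols[OF U])
  also have "\<dots> = 1" using PP j by (simp add: orthonormal_cols_iff[OF P] power2_eq_square)
  finally have \<alpha>: "(\<Sum>i<p. (\<alpha> i)\<^sup>2) \<le> 1" .
  have "(\<Sum>i<p. (\<beta> i)\<^sup>2) \<le> (\<Sum>l<n. (C $$ (l, j))\<^sup>2)"
    unfolding \<beta>_def by (rule bessel_inequality_cols[OF V])
  also have "\<dots> = 1" using D(4) j by (simp add: orthonormal_cols_iff[OF D(3)] power2_eq_square)
  finally have \<beta>: "(\<Sum>i<p. (\<beta> i)\<^sup>2) \<le> 1" .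
  have "\<tau> ! j = mat_diag q (\<lambda>i. \<tau> ! i) $$ (j, j)" using j by (simp add: mat_diag_def)
  also have "\<dots> = (\<Sum>i<p. (P\<^sup>T * U) $$ (j, i) * d i * (C\<^sup>T * V) $$ (j, i))"
    unfolding T by (rule diag_conj_entry[of _ q p _ q]) (use P U V D(3) j in auto)
  also have "\<dots> = (\<Sum>i<p. \<alpha> i * d i * \<beta> i)"
    by (rule sum.cong)
      (use P U V D(3) j in \<open>auto simp: scalar_prod_def \<alpha>_def \<beta>_def atLeast0LessThan\<close>)
  also have "\<dots> \<le> (\<Sum>i<p. \<gamma> * (((\<alpha> i)\<^sup>2 + (\<beta> i)\<^sup>2) / 2))"
  proof (rule sum_mono)
    fix i assume "i \<in> {..<p}"
    then have i: "0 \<le> d i" "d i \<le> \<gamma>" using d by auto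
    have "\<alpha> i * d i * \<beta> i = d i * (\<alpha> i * \<beta> i)" by simp
    also have "\<dots> \<le> d i * (((\<alpha> i)\<^sup>2 + (\<beta> i)\<^sup>2) / 2)"
      by (rule mult_left_mono) (use i sum_squares_bound[of "\<alpha> i" "\<beta> i"] in auto)
    also have "\<dots> \<le> \<gamma> * (((\<alpha> i)\<^sup>2 + (\<beta> i)\<^sup>2) / 2)"
      by (rule mult_right_mono) (use i in auto)
    finally show "\<alpha> i * d i * \<beta> i \<le> \<gamma> * (((\<alpha> i)\<^sup>2 + (\<beta> i)\<^sup>2) / 2)" .
  qed
  also have "\<dots> = \<gamma> * (((\<Sum>i<p. (\<alpha> i)\<^sup>2) + (\<Sum>i<p. (\<beta> i)\<^sup>2)) / 2)"
    by (simp add: sum_distrib_left[symmetric] sum_divide_distrib[symmetric] sum.distrib)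
  also have "\<dots> \<le> \<gamma> * 1"
    by (rule mult_left_mono) (use \<alpha> \<beta> \<gamma> in auto)
  finally show ?thesis by simp
qed

text \<open>In a non-increasing list the entries above a bound form an initial segment, so counting
  them locates the cut.\<close>

lemma nth_gt_iff_less_length_filter:
  fixes xs :: "'a :: linorder list"
  assumes anti: "\<And>i j. i \<le> j \<Longrightarrow> j < length xs \<Longrightarrow> xs ! j \<le> xs ! i" and i: "i < length xs"
  shows "g < xs ! i \<longleftrightarrow> i < length (filter (\<lambda>s. g < s) xs)"
proof -
  let ?S = "{i. i < length xs \<and> g < xs ! i}"
  have card: "length (filter (\<lambda>s. g < s) xs) = card ?S" by (rule length_filter_conv_card)
  show ?thesis
  proof
    assume "g < xs ! i"
    then have "g < xs ! j" if "j \<le> i" for j using anti[OF that i] by simp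
    then have "{..i} \<subseteq> ?S" using i by auto
    then have "card {..i} \<le> card ?S" by (intro card_mono) auto
    then show "i < length (filter (\<lambda>s. g < s) xs)" by (simp add: card)
  next
    assume *: "i < length (filter (\<lambda>s. g < s) xs)"
    show "g < xs ! i"
    proof (rule ccontr)
      assume "\<not> g < xs ! i"
      then have "\<not> g < xs ! j" if "i \<le> j" "j < length xs" for j using anti[OF that] by simp
      then have "?S \<subseteq> {..<i}" by (auto simp: not_le[symmetric])
      then have "card ?S \<le> card {..<i}" by (intro card_mono) auto
      then show False using * by (simp add: card)
    qed
  qed
qed

theorem mainTheorem3:
  fixes m n k khat :: nat
    and \<mu> \<gamma> :: real
    and rhat ystar :: "real \<Rightarrow> real"
    and Z Q Uk Vk :: "real mat"
    and \<sigma>k :: "real list"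
  assumes "m \<le> n"
    and "concave_on {0..} rhat"
    and "mono_on {0..} rhat"
    and "rhat 0 = 0"
    and "\<mu> > 0"
    and "is_scalar_prox \<mu> rhat ystar"
    and "Z \<in> carrier_mat m n"
    and "\<gamma> > 0"
    and "\<And>\<sigma>. 0 \<le> \<sigma> \<Longrightarrow> \<sigma> \<le> \<gamma> \<Longrightarrow> ystar \<sigma> = 0"
    and "khat = length (filter (\<lambda>s. s > \<gamma>) (singular_values Z))"
    and "is_truncated_svd khat Z Uk \<sigma>k Vk"
    and "khat \<le> k"
    and "Q \<in> carrier_mat m k"
    and "Q\<^sup>T * Q = 1\<^sub>m k"
    and "vec_space.col_space m Uk \<subseteq> vec_space.col_space m Q"
  shows "prox \<mu> rhat ystar Z = Q * prox \<mu> rhat ystar (Q\<^sup>T * Z)"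
proof -
  note prox = assms(6) and Z = assms(7) and Q = assms(13,14)
  have y0: "ystar 0 = 0" using assms(8,9) by simp
  define p where "p = min m n"
  \<comment> \<open>The decomposition chosen is the one behind the truncation, so that the columns
    of \<open>Uk\<close> are columns of this same \<open>U\<close>.\<close>
  obtain U \<sigma> V where svd: "is_svd Z U \<sigma> V" and Uk: "Uk = first_cols khat U" and kp: "khat \<le> p"
    using assms(11) Z by (auto simp: is_truncated_svd_def p_def)
  note D = is_svdD[OF svd Z, folded p_def]
  have sv: "\<gamma> < \<sigma> ! i \<longleftrightarrow> i < khat" if "i < p" for i
    using nth_gt_iff_less_length_filter[of \<sigma> i \<gamma>] D(5,7) that assms(10)
    by (simp add: singular_values_eqI[OF svd])
  define d1 where "d1 i = (if i < khat then \<sigma> ! i else 0)" for i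
  define d2 where "d2 i = (if i < khat then 0 else \<sigma> ! i)" for i
  have d2: "0 \<le> d2 i" "d2 i \<le> \<gamma>" if "i < p" for i
    using D(6)[OF that] sv[OF that] assms(8) by (auto simp: d2_def)
  define Z1 where "Z1 = U * mat_diag p d1 * V\<^sup>T"
  define Z2 where "Z2 = U * mat_diag p d2 * V\<^sup>T"
  have Z1: "Z1 \<in> carrier_mat m n" and Z2: "Z2 \<in> carrier_mat m n"
    unfolding Z1_def Z2_def using D(1,3) by (rule diag_conj_carrier)+
  have Zsum: "Z = Z1 + Z2"
  proof -
    have "(\<lambda>i. d1 i + d2 i) = (\<lambda>i. \<sigma> ! i)" by (auto simp: d1_def d2_def)
    then show ?thesis unfolding Z1_def Z2_def diag_conj_add[OF D(1,3)] using D(8) by simp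
  qed
  \<comment> \<open>The diagonals \<open>d1\<close> and \<open>d2\<close> have disjoint supports, so
    their pointwise product is zero.\<close>
  have orth: "Z1\<^sup>T * Z2 = 0\<^sub>m n n" "Z1 * Z2\<^sup>T = 0\<^sub>m m m"
    unfolding Z1_def Z2_def diag_conj_transpose[OF D(1,3)]
      diag_conj_mult[OF D(3,1,2,3)] diag_conj_mult[OF D(1,3,4,1)]
    by (rule diag_conj_zero[OF D(3,3)] diag_conj_zero[OF D(1,1)]; simp add: d1_def d2_def)+
  \<comment> \<open>A unit vector selects the column from \<open>Uk\<close>; the inclusion of the
    column spans then provides the preimage under \<open>Q\<close>.\<close>
  have range: "\<exists>x\<in>carrier_vec k. Q *\<^sub>v x = col U j" if j: "j < khat" for j
  proof -
    have Uk': "Uk = mat_of_cols m (take khat (cols U))"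
      using D(1) by (simp add: Uk first_cols_def)
    have UkC: "Uk \<in> carrier_mat m khat"
      unfolding Uk' using mat_of_cols_carrier(1)[of m "take khat (cols U)"] D(1) kp by simp
    have colU: "col U j \<in> carrier_vec m" using D(1) j kp by (intro col_carrier_vec) auto
    have "Uk *\<^sub>v unit_vec khat j = col (Uk * 1\<^sub>m khat) j"
      by (subst col_mult2[OF UkC one_carrier_mat j]) (use j in simp)
    also have "\<dots> = col Uk j" by (simp only: right_mult_one_mat[OF UkC])
    also have "\<dots> = col U j"
      unfolding Uk' using col_mat_of_cols[of j "take khat (cols U)" m] j kp D(1) colU by simp
    finally have "col U j \<in> vec_space.col_space m Uk"
      unfolding vec_space.col_space_eq[OF UkC] using UkC colU
      by (intro CollectI conjI bexI[of _ "unit_vec khat j"]) auto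
    then have "col U j \<in> vec_space.col_space m Q" using assms(15) by blast
    then show ?thesis unfolding vec_space.col_space_eq[OF Q(1)] using Q(1) by auto
  qed
  \<comment> \<open>The map \<open>Q * Q\<^sup>T\<close> fixes every vector of the form
    \<open>Q *\<^sub>v y\<close>. Each column of \<open>M\<close> has this form: a multiple of a
    leading column of \<open>U\<close>, or zero beyond the cut.\<close>
  have QQZ1: "Q * (Q\<^sup>T * Z1) = Z1"
  proof -
    define M where "M = U * mat_diag p d1"
    have M: "M \<in> carrier_mat m p" unfolding M_def using D(1) by (intro mult_carrier_mat[of _ m p]) auto
    have "Q * (Q\<^sup>T * M) = M"
    proof (rule mat_col_eqI)
      fix j assume "j < dim_col M"
      then have j: "j < p" using M by simp
      have colM: "col M j = d1 j \<cdot>\<^sub>v col U j"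
        unfolding M_def mat_diag_mult_right[OF D(1)] using j D(1) by (intro eq_vecI) auto
      have "\<exists>y\<in>carrier_vec k. col M j = Q *\<^sub>v y"
      proof (cases "j < khat")
        case True
        from range[OF True] obtain x where "x \<in> carrier_vec k" "Q *\<^sub>v x = col U j" by blast
        then show ?thesis using Q(1) colM by (intro bexI[of _ "d1 j \<cdot>\<^sub>v x"]) (auto simp: mult_mat_vec)
      next
        case False
        then have "col M j = 0\<^sub>v m" using colM D(1) j by (auto simp: d1_def)
        then show ?thesis using Q(1) by (intro bexI[of _ "0\<^sub>v k"]) auto
      qed
      then obtain y where y: "y \<in> carrier_vec k" "col M j = Q *\<^sub>v y" by blast
      have "col (Q * (Q\<^sup>T * M)) j = Q *\<^sub>v (Q\<^sup>T *\<^sub>v (Q *\<^sub>v y))"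
        using col_mult2[of Q m k "Q\<^sup>T * M" p j] col_mult2[of "Q\<^sup>T" k m M p j] Q(1) M j y by simp
      also have "Q\<^sup>T *\<^sub>v (Q *\<^sub>v y) = (Q\<^sup>T * Q) *\<^sub>v y"
        by (rule assoc_mult_mat_vec[symmetric, of _ k m _ k]) (use Q(1) y in auto)
      finally show "col (Q * (Q\<^sup>T * M)) j = col M j" unfolding Q(2) using y by simp
    qed (use M Q in auto)
    moreover have "Q * (Q\<^sup>T * Z1) = Q * (Q\<^sup>T * M) * V\<^sup>T"
    proof -
      have "Q\<^sup>T * Z1 = (Q\<^sup>T * M) * V\<^sup>T"
        unfolding Z1_def M_def[symmetric]
        by (rule assoc_mult_mat[symmetric, of _ k m _ p _ n]) (use Q M D(3) in auto)
      moreover have "Q * ((Q\<^sup>T * M) * V\<^sup>T) = Q * (Q\<^sup>T * M) * V\<^sup>T"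
        by (rule assoc_mult_mat[symmetric, of _ m k _ p _ n]) (use Q M D(3) in auto)
      ultimately show ?thesis by simp
    qed
    ultimately show ?thesis by (simp add: Z1_def M_def)
  qed
  define B1 where "B1 = Q\<^sup>T * Z1"
  define B2 where "B2 = Q\<^sup>T * Z2"
  have B1: "B1 \<in> carrier_mat k n" and B2: "B2 \<in> carrier_mat k n"
    using Q Z1 Z2 by (auto simp: B1_def B2_def)
  have Bsum: "Q\<^sup>T * Z = B1 + B2"
    unfolding Zsum B1_def B2_def by (rule mult_add_distrib_mat[of _ k m _ n]) (use Q Z1 Z2 in auto)
  have B: "Q\<^sup>T * Z \<in> carrier_mat k n" using Q Z by auto
  \<comment> \<open>The columns of \<open>Z2\<close> may leave the span of \<open>Q\<close>. In the
    first product \<open>Q\<close> is moved onto \<open>B1\<close>, where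
    \<open>Q * B1 = Z1\<close>; in the second one the inner factor \<open>Z1 * Z2\<^sup>T\<close>
    already vanishes.\<close>
  have Borth: "B1\<^sup>T * B2 = 0\<^sub>m n n" "B1 * B2\<^sup>T = 0\<^sub>m k k"
  proof -
    have B1t: "B1\<^sup>T = Z1\<^sup>T * Q" and B2t: "B2\<^sup>T = Z2\<^sup>T * Q"
      using transpose_mult[of "Q\<^sup>T" k m Z1 n] transpose_mult[of "Q\<^sup>T" k m Z2 n] Q Z1 Z2
      by (simp_all add: B1_def B2_def)
    have "B1\<^sup>T * B2 = B1\<^sup>T * Q\<^sup>T * Z2"
      unfolding B2_def by (rule assoc_mult_mat[symmetric, of _ n k _ m _ n]) (use B1 Q Z2 in auto)
    also have "B1\<^sup>T * Q\<^sup>T = (Q * B1)\<^sup>T" by (rule transpose_mult[symmetric, OF Q(1) B1])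
    also have "Q * B1 = Z1" using QQZ1 by (simp add: B1_def)
    finally show "B1\<^sup>T * B2 = 0\<^sub>m n n" using orth by simp
    have "B1 * B2\<^sup>T = Q\<^sup>T * (Z1 * (Z2\<^sup>T * Q))"
      unfolding B2t B1_def by (rule assoc_mult_mat[of _ k m _ n _ k]) (use Z1 Q Z2 in auto)
    also have "Z1 * (Z2\<^sup>T * Q) = Z1 * Z2\<^sup>T * Q"
      by (rule assoc_mult_mat[symmetric, of _ m n _ m _ k]) (use Z1 Q Z2 in auto)
    finally show "B1 * B2\<^sup>T = 0\<^sub>m k k" unfolding orth(2) using Q by simp
  qed
  define q where "q = min k n"
  obtain A \<tau> C where Bsvd: "is_svd (Q\<^sup>T * Z) A \<tau> C" using svd_exists by blast
  note BD = is_svdD[OF Bsvd B, folded q_def]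
  \<comment> \<open>Compression may change the singular values of \<open>Z2\<close>, so
    \<open>B2\<close> gets its own decomposition; only the bound by \<open>\<gamma>\<close> carries
    over.\<close>
  obtain A' \<tau>' C' where B2svd: "is_svd B2 A' \<tau>' C'" using svd_exists by blast
  note B2D = is_svdD[OF B2svd B2, folded q_def]
  have \<tau>': "0 \<le> \<tau>' ! i" "\<tau>' ! i \<le> \<gamma>" if "i < q" for i
  proof -
    show "0 \<le> \<tau>' ! i" by (rule B2D(6)[OF that])
    show "\<tau>' ! i \<le> \<gamma>"
      by (rule compression_singular_value_le[OF Q D(1-4) d2 _ B2svd[unfolded B2_def Z2_def]])
        (use assms(8) that in \<open>auto simp: q_def\<close>)
  qed
  \<comment> \<open>A single polynomial has to serve all three matrices: it computes both proximal
    operators, from \<open>Z\<close> and from \<open>Q\<^sup>T * Z\<close>, and it must vanish on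
    \<open>B2\<close>.\<close>
  obtain cs where cs: "\<And>x. x \<in> set \<sigma> \<union> set \<tau> \<union> set \<tau>' \<Longrightarrow> x * poly (Poly cs) (x\<^sup>2) = ystar x"
  proof (rule odd_interpolation_exists[of "set \<sigma> \<union> set \<tau> \<union> set \<tau>'" ystar])
    show "0 \<le> x" if "x \<in> set \<sigma> \<union> set \<tau> \<union> set \<tau>'" for x
      using that D(5,6) BD(5,6) B2D(5,6) by (auto simp: in_set_conv_nth)
  qed (use y0 in auto)
  have "prox \<mu> rhat ystar Z = odd_matpoly cs Z"
  proof -
    have "mat_diag p (\<lambda>i. \<sigma> ! i * poly (Poly cs) ((\<sigma> ! i)\<^sup>2)) = mat_diag p (\<lambda>i. ystar (\<sigma> ! i))"
      by (rule mat_diag_cong) (use cs D(5) in auto)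
    then show ?thesis
      using prox_eq[OF prox y0 svd Z] odd_matpoly_diag_conj[OF D(1-4), of cs "(!) \<sigma>"] D(8)
      by (simp add: p_def)
  qed
  also have "\<dots> = odd_matpoly cs Z1 + odd_matpoly cs Z2"
    unfolding Zsum by (rule odd_matpoly_add[OF Z1 Z2 orth])
  \<comment> \<open>An entry of \<open>d2\<close> is either 0, a root of every odd polynomial, or a
    singular value at most \<open>\<gamma>\<close>, where the interpolated \<open>ystar\<close> is
    0.\<close>
  also have "odd_matpoly cs Z2 = 0\<^sub>m m n"
    unfolding Z2_def odd_matpoly_diag_conj[OF D(1-4)]
  proof (rule diag_conj_zero[OF D(1,3)])
    fix i assume i: "i < p"
    show "d2 i * poly (Poly cs) ((d2 i)\<^sup>2) = 0"
      using cs[of "\<sigma> ! i"] assms(9)[OF d2[OF i]] D(5) i by (auto simp: d2_def)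
  qed
  also have "odd_matpoly cs Z1 + 0\<^sub>m m n = odd_matpoly cs Z1" using Z1 by auto
  also have "\<dots> = Q * odd_matpoly cs B1"
    unfolding B1_def by (rule odd_matpoly_projection[OF Z1 Q(1) QQZ1, symmetric])
  also have "odd_matpoly cs B1 = odd_matpoly cs B1 + 0\<^sub>m k n" using B1 by auto
  also have "0\<^sub>m k n = odd_matpoly cs B2"
  proof -
    have "odd_matpoly cs B2 = A' * mat_diag q (\<lambda>i. \<tau>' ! i * poly (Poly cs) ((\<tau>' ! i)\<^sup>2)) * C'\<^sup>T"
      using odd_matpoly_diag_conj[OF B2D(1-4), of cs "(!) \<tau>'"] B2D(8) by simp
    also have "\<dots> = 0\<^sub>m k n"
      by (rule diag_conj_zero[OF B2D(1,3)]) (use cs assms(9) \<tau>' B2D(5) in auto)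
    finally show ?thesis by simp
  qed
  also have "odd_matpoly cs B1 + odd_matpoly cs B2 = odd_matpoly cs (Q\<^sup>T * Z)"
    unfolding Bsum by (rule odd_matpoly_add[OF B1 B2 Borth, symmetric])
  also have "\<dots> = prox \<mu> rhat ystar (Q\<^sup>T * Z)"
  proof -
    have "mat_diag q (\<lambda>i. \<tau> ! i * poly (Poly cs) ((\<tau> ! i)\<^sup>2)) = mat_diag q (\<lambda>i. ystar (\<tau> ! i))"
      by (rule mat_diag_cong) (use cs BD(5) in auto)
    then show ?thesis
      using prox_eq[OF prox y0 Bsvd B] odd_matpoly_diag_conj[OF BD(1-4), of cs "(!) \<tau>"] BD(8)
      by (simp add: q_def)
  qed
  finally show ?thesis .
qed

end
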